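(* Let $N, r\in\mathbb{N}$, let $\varphi\in C^0(\mathbb{R}^N)$ and $\psi\in L^1(\mathbb{R}^N)$ be real-valued, and let $\mathbf{p}=(p_1,\dots,p_N):\mathbb{N}\to\mathbb{R}^N$ satisfy $p_i(n)>0$ for all $i$ and $n$, $\lim_{n\to\infty}p_i(n)=+\infty$ and $\lim_{n\to\infty} n/p_i(n)=a_i>0$ for every $i=1,\dots,N$; put $\mathbf{a}=(a_1,\dots,a_N)$. Assume: (A1) for every $\mathbf{u}\in\mathbb{R}^N$, $\sum_{\mathbf{k}\in\mathbb{Z}^N}\varphi(\mathbf{u}-\mathbf{k})=1$, and $\int_{\mathbb{R}^N}\psi(\mathbf{t})\,d\mathbf{t}=1$; (A2) for every $\nu=1,\dots,r$ and every $\mathbf{h}\in\mathbb{N}_0^N$ with $|\mathbf{h}|=\nu$, the moment $m^\nu_{\mathbf{h}}(\varphi,\mathbf{u})$ is a real number independent of $\mathbf{u}\in\mathbb{R}^N$, denoted $m^\nu_{\mathbf{h}}(\varphi)$; (A3) $M_r(\varphi)+\widetilde{M}_r(\psi)<+\infty$ and $\lim_{w\to+\infty}\sum_{\|\mathbf{u}-\mathbf{k}\|>w}|\varphi(\mathbf{u}-\mathbf{k})|\,\|\mathbf{u}-\mathbf{k}\|^r=0$ uniformly with respect to $\mathbf{u}\in\mathbb{R}^N$. Let $f\in L^\infty(\mathbb{R}^N)$, let $\mathbf{x}\in\mathbb{R}^N$ be fixed, and assume that $f$ belongs to $C^r$ locally at $\mathbf{x}$. Then: (i) If $r=1$, $$\lim_{n\to+\infty}n\big[(S^{\varphi,\psi}_{\mathbf{p}(n)}f)(\mathbf{x})-f(\mathbf{x})\big]=\sum_{|\mathbf{h}|=1}\mathbf{a}^{\mathbf{h}}D^{\mathbf{h}}f(\mathbf{x})\sum_{\mathbf{s}=\mathbf{0}}^{\mathbf{h}}\binom{\mathbf{h}}{\mathbf{s}}m^{|\mathbf{h}-\mathbf{s}|}_{\mathbf{h}-\mathbf{s}}(\varphi)\,\widetilde{m}^{|\mathbf{s}|}_{\mathbf{s}}(\psi)=\sum_{k=1}^N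 a_k\frac{\partial f}{\partial x_k}(\mathbf{x})\{m^1_{\mathbf{e}_k}(\varphi)+\widetilde{m}^1_{\mathbf{e}_k}(\psi)\}.$$ (ii) If $r>1$ and if moreover $m^\nu_{\mathbf{h}}(\varphi)=\widetilde{m}^\nu_{\mathbf{h}}(\psi)=0$ for every $\mathbf{h}\in\mathbb{N}_0^N$ with $|\mathbf{h}|=\nu$ and every $\nu=1,\dots,r-1$, and $m^r_{\mathbf{h}}(\varphi),\widetilde{m}^r_{\mathbf{h}}(\psi)\neq0$ for some $\mathbf{h}$ with $|\mathbf{h}|=r$, then $$\lim_{n\to+\infty}n^r\big[(S^{\varphi,\psi}_{\mathbf{p}(n)}f)(\mathbf{x})-f(\mathbf{x})\big]=\sum_{|\mathbf{h}|=r}\mathbf{a}^{\mathbf{h}}\frac{D^{\mathbf{h}}f(\mathbf{x})}{\mathbf{h}!}\sum_{\mathbf{s}=\mathbf{0}}^{\mathbf{h}}\binom{\mathbf{h}}{\mathbf{s}}m^{|\mathbf{h}-\mathbf{s}|}_{\mathbf{h}-\mathbf{s}}(\varphi)\,\widetilde{m}^{|\mathbf{s}|}_{\mathbf{s}}(\psi).$$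
   Context: Notation. $\mathbb{N}$ is the set of positive integers, $\mathbb{N}_0$ the non-negative integers. $\|\cdot\|$ is the Euclidean norm on $\mathbb{R}^N$; $\mathbf{e}_1,\dots,\mathbf{e}_N$ is the standard basis. For $\mathbf{x},\mathbf{y}\in\mathbb{R}^N$: $\mathbf{x}\mathbf{y}=(x_1y_1,\dots,x_Ny_N)$ (componentwise product), $\langle\mathbf{x}\rangle=\prod_{i=1}^N x_i$, $[\mathbf{x}]=(|x_1|,\dots,|x_N|)$, and $\mathbf{x}^{\mathbf{h}}=\prod_i x_i^{h_i}$ for $\mathbf{h}\in\mathbb{N}_0^N$. Multi-indices: $|\mathbf{h}|=h_1+\dots+h_N$, $\mathbf{h}!=\prod_i h_i!$, $\binom{\mathbf{h}}{\mathbf{s}}=\prod_i\binom{h_i}{s_i}$, $D^{\mathbf{h}}f=\partial^{|\mathbf{h}|}f/\partial x_1^{h_1}\cdots\partial x_N^{h_N}$; sums $\sum_{|\mathbf{h}|=\nu}$ run over $\mathbf{h}\in\mathbb{N}_0^N$, and $\sum_{\mathbf{s}=\mathbf{0}}^{\mathbf{h}}$ runs over $\mathbf{s}\in\mathbb{N}_0^N$ with $s_i\le h_i$ for all $i$. Function spaces. $C^0=C^0(\mathbb{R}^N)$ is the space of bounded uniformly continuous functions $\mathbb{R}^N\to\mathbb{R}$. A function $f$ belongs to $C^r$ locally at $\mathbf{x}$ if there is a neighbourhood $U$ of $\mathbf{x}$ such that $f$ is $(r-1)$-fold continuously differentiable in $U$ and the $r$-th order derivatives exist and are continuous at $\mathbf{x}$.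 Moments. For $\nu\in\mathbb{N}_0$, $\mathbf{h}\in\mathbb{N}_0^N$ with $|\mathbf{h}|=\nu$: $m^\nu_{\mathbf{h}}(\varphi,\mathbf{u})=\sum_{\mathbf{k}\in\mathbb{Z}^N}\varphi(\mathbf{u}-\mathbf{k})(\mathbf{k}-\mathbf{u})^{\mathbf{h}}$, $\widetilde{m}^\nu_{\mathbf{h}}(\psi)=\int_{\mathbb{R}^N}\mathbf{t}^{\mathbf{h}}\psi(\mathbf{t})\,d\mathbf{t}$, $M^\nu_{\mathbf{h}}(\varphi)=\sup_{\mathbf{u}\in\mathbb{R}^N}\sum_{\mathbf{k}\in\mathbb{Z}^N}|\varphi(\mathbf{u}-\mathbf{k})|[\mathbf{u}-\mathbf{k}]^{\mathbf{h}}$, $\widetilde{M}^\nu_{\mathbf{h}}(\psi)=\int_{\mathbb{R}^N}[\mathbf{t}]^{\mathbf{h}}|\psi(\mathbf{t})|\,d\mathbf{t}$, $M_\nu(\varphi)=\max_{|\mathbf{h}|=\nu}M^\nu_{\mathbf{h}}(\varphi)$, $\widetilde{M}_\nu(\psi)=\max_{|\mathbf{h}|=\nu}\widetilde{M}^\nu_{\mathbf{h}}(\psi)$. When $m^\nu_{\mathbf{h}}(\varphi,\mathbf{u})$ does not depend on $\mathbf{u}$ it is written $m^\nu_{\mathbf{h}}(\varphi)$; in particular $m^0_{\mathbf{0}}(\varphi)=1$ under (A1). Operator. The multivariate generalized Durrmeyer sampling type series is $$(S^{\varphi,\psi}_{\mathbf{p}(n)}f)(\mathbf{x})=\sum_{\mathbf{k}\in\mathbb{Z}^N}\varphi(\mathbf{p}(n)\mathbf{x}-\mathbf{k})\Big[\langle\mathbf{p}(n)\rangle\int_{\mathbb{R}^N}\psi(\mathbf{p}(n)\mathbf{u}-\mathbf{k})f(\mathbf{u})\,d\mathbf{u}\Big],\quad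 \mathbf{x}\in\mathbb{R}^N.$$ *)

theory Defs
  imports "HOL-Analysis.Analysis"
begin

text \<open>
  A point of \<open>N\<close>-dimensional space is a vector in \<^typ>\<open>real ^ 'n\<close>, a multi-index is a vector in
  \<^typ>\<open>nat ^ 'n\<close>, and a lattice point is a vector in \<^typ>\<open>int ^ 'n\<close>. On vectors, the library's
  \<open>*\<close>, \<open>-\<close>, \<open>\<le>\<close> and \<open>\<bar>_\<bar>\<close> are componentwise, so \<open>{..h}\<close> is the set of multi-indices \<open>s \<le> h\<close>.
\<close>

definition vprod :: "real ^ 'n::finite \<Rightarrow> real" where
  "vprod x = (\<Prod>i\<in>UNIV. x $ i)"

definition vpow :: "real ^ 'n::finite \<Rightarrow> nat ^ 'n \<Rightarrow> real" where
  "vpow x h = (\<Prod>i\<in>UNIV. (x $ i) ^ (h $ i))"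

definition mi_size :: "nat ^ 'n::finite \<Rightarrow> nat" where
  "mi_size h = (\<Sum>i\<in>UNIV. h $ i)"

definition mi_fact :: "nat ^ 'n::finite \<Rightarrow> nat" where
  "mi_fact h = (\<Prod>i\<in>UNIV. fact (h $ i))"

definition mi_binom :: "nat ^ 'n::finite \<Rightarrow> nat ^ 'n \<Rightarrow> nat" where
  "mi_binom h s = (\<Prod>i\<in>UNIV. (h $ i) choose (s $ i))"

definition lat :: "int ^ 'n::finite \<Rightarrow> real ^ 'n" where
  "lat k = (\<chi> i. real_of_int (k $ i))"

lemma finite_mi_atMost: "finite {..h :: nat ^ 'n::finite}"
proof -
  have "{..h} \<subseteq> vec_lambda ` (\<Pi>\<^sub>E i\<in>UNIV. {..h $ i})"
  proof
    fix s assume "s \<in> {..h}"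
    then have "vec_nth s \<in> (\<Pi>\<^sub>E i\<in>UNIV. {..h $ i})"
      by (auto simp: less_eq_vec_def)
    then have "vec_lambda (vec_nth s) \<in> vec_lambda ` (\<Pi>\<^sub>E i\<in>UNIV. {..h $ i})"
      by (rule imageI)
    then show "s \<in> vec_lambda ` (\<Pi>\<^sub>E i\<in>UNIV. {..h $ i})"
      by simp
  qed
  then show ?thesis
    by (rule finite_subset) (auto intro!: finite_PiE)
qed

lemma finite_mi_size: "finite {h :: nat ^ 'n::finite. mi_size h = r}"
proof -
  have "{h :: nat ^ 'n. mi_size h = r} \<subseteq> {..(\<chi> i. r)}"
    by (auto simp: mi_size_def less_eq_vec_def intro!: member_le_sum)
  then show ?thesis
    using finite_mi_atMost finite_subset by blast
qed


definition partial_differentiable ::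
    "'n::finite \<Rightarrow> (real ^ 'n \<Rightarrow> real) \<Rightarrow> real ^ 'n \<Rightarrow> bool" where
  "partial_differentiable i f x \<longleftrightarrow> (\<lambda>t. f (x + t *\<^sub>R axis i 1)) field_differentiable (at 0)"

definition partial :: "'n::finite \<Rightarrow> (real ^ 'n \<Rightarrow> real) \<Rightarrow> real ^ 'n \<Rightarrow> real" where
  "partial i f x = deriv (\<lambda>t. f (x + t *\<^sub>R axis i 1)) 0"

text \<open>The last direction of the list is differentiated first.\<close>

definition partials :: "'n::finite list \<Rightarrow> (real ^ 'n \<Rightarrow> real) \<Rightarrow> real ^ 'n \<Rightarrow> real" where
  "partials is f = foldr partial is f"

text \<open>
  The linear order on the index type plays the role of the numbering \<open>1, \<dots>, N\<close> of the
  coordinates; it fixes the order of differentiation in the symbol for the mixed derivative.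
\<close>

definition mi_deriv ::
    "nat ^ 'n::{finite,linorder} \<Rightarrow> (real ^ 'n::{finite,linorder} \<Rightarrow> real) \<Rightarrow>
     real ^ 'n::{finite,linorder} \<Rightarrow> real" where
  "mi_deriv h f =
     partials (concat (map (\<lambda>i. replicate (h $ i) i) (sorted_list_of_set UNIV))) f"

definition partials_exist_on ::
    "nat \<Rightarrow> (real ^ 'n::finite) set \<Rightarrow> (real ^ 'n \<Rightarrow> real) \<Rightarrow> bool" where
  "partials_exist_on m U f \<longleftrightarrow>
     (\<forall>is i. Suc (length is) \<le> m \<longrightarrow> (\<forall>y\<in>U. partial_differentiable i (partials is f) y))"

definition C_on :: "nat \<Rightarrow> (real ^ 'n::finite) set \<Rightarrow> (real ^ 'n \<Rightarrow> real) \<Rightarrow> bool" where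
  "C_on m U f \<longleftrightarrow>
     partials_exist_on m U f \<and> (\<forall>is. length is \<le> m \<longrightarrow> continuous_on U (partials is f))"

text \<open>
  For \<open>r \<ge> 1\<close>. Continuity at \<open>x\<close> of the derivatives of order \<open>r\<close> presupposes that they exist near
  \<open>x\<close>; shrinking the neighbourhood, they exist on the same \<open>U\<close>.
\<close>

definition locally_C_at :: "nat \<Rightarrow> (real ^ 'n::finite \<Rightarrow> real) \<Rightarrow> real ^ 'n \<Rightarrow> bool" where
  "locally_C_at r f x \<longleftrightarrow>
     (\<exists>U. open U \<and> x \<in> U \<and> C_on (r - 1) U f \<and> partials_exist_on r U f \<and>
        (\<forall>is. length is = r \<longrightarrow> isCont (partials is f) x))"


definition bounded_unif_cont :: "(real ^ 'n::finite \<Rightarrow> real) \<Rightarrow> bool" where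
  "bounded_unif_cont f \<longleftrightarrow> bounded (range f) \<and> uniformly_continuous_on UNIV f"

definition L_infinity :: "(real ^ 'n::finite \<Rightarrow> real) \<Rightarrow> bool" where
  "L_infinity f \<longleftrightarrow>
     f \<in> borel_measurable lebesgue \<and> (\<exists>C. AE x in lebesgue. \<bar>f x\<bar> \<le> C)"


text \<open>
  The order \<open>\<nu>\<close> of a moment is always \<^term>\<open>mi_size h\<close> and is therefore not a separate argument.
  Absolute moments take values in \<^typ>\<open>ennreal\<close>, so that finiteness is a genuine condition.
\<close>

definition disc_moment :: "(real ^ 'n::finite \<Rightarrow> real) \<Rightarrow> nat ^ 'n \<Rightarrow> real ^ 'n \<Rightarrow> real" where
  "disc_moment \<phi> h u = (\<Sum>\<^sub>\<infinity>k. \<phi> (u - lat k) * vpow (lat k - u) h)"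

text \<open>Meaningful only if \<^term>\<open>disc_moment \<phi> h u\<close> does not depend on \<open>u\<close>.\<close>

definition disc_moment_const :: "(real ^ 'n::finite \<Rightarrow> real) \<Rightarrow> nat ^ 'n \<Rightarrow> real" where
  "disc_moment_const \<phi> h = (THE c. \<forall>u. disc_moment \<phi> h u = c)"

definition cont_moment :: "(real ^ 'n::finite \<Rightarrow> real) \<Rightarrow> nat ^ 'n \<Rightarrow> real" where
  "cont_moment \<psi> h = (LINT t|lebesgue. vpow t h * \<psi> t)"

definition disc_abs_moment :: "(real ^ 'n::finite \<Rightarrow> real) \<Rightarrow> nat ^ 'n \<Rightarrow> ennreal" where
  "disc_abs_moment \<phi> h =
     (SUP u. \<Sum>\<^sub>\<infinity>k. ennreal (\<bar>\<phi> (u - lat k)\<bar> * vpow \<bar>u - lat k\<bar> h))"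

definition cont_abs_moment :: "(real ^ 'n::finite \<Rightarrow> real) \<Rightarrow> nat ^ 'n \<Rightarrow> ennreal" where
  "cont_abs_moment \<psi> h = (\<integral>\<^sup>+ t. ennreal (vpow \<bar>t\<bar> h * \<bar>\<psi> t\<bar>) \<partial>lebesgue)"

definition max_disc_abs_moment :: "nat \<Rightarrow> (real ^ 'n::finite \<Rightarrow> real) \<Rightarrow> ennreal" where
  "max_disc_abs_moment \<nu> \<phi> = Max (disc_abs_moment \<phi> ` {h. mi_size h = \<nu>})"

definition max_cont_abs_moment :: "nat \<Rightarrow> (real ^ 'n::finite \<Rightarrow> real) \<Rightarrow> ennreal" where
  "max_cont_abs_moment \<nu> \<psi> = Max (cont_abs_moment \<psi> ` {h. mi_size h = \<nu>})"


text \<open>The argument \<open>w\<close> is the value \<open>p(n)\<close> of the scaling sequence.\<close>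

definition durrmeyer_series ::
    "(real ^ 'n::finite \<Rightarrow> real) \<Rightarrow> (real ^ 'n \<Rightarrow> real) \<Rightarrow> real ^ 'n \<Rightarrow>
     (real ^ 'n \<Rightarrow> real) \<Rightarrow> real ^ 'n \<Rightarrow> real" where
  "durrmeyer_series \<phi> \<psi> w f x =
     (\<Sum>\<^sub>\<infinity>k. \<phi> (w * x - lat k) *
        (vprod w * (LINT u|lebesgue. \<psi> (w * u - lat k) * f u)))"

end

theory Submission
  imports Defs "HOL-Library.Landau_Symbols"
begin

text \<open>
  Write \<open>f = P(\<cdot> - x) + R\<close> with \<open>P\<close> the Taylor polynomial of order \<open>r\<close> at \<open>x\<close>. Substituting
  \<open>u = (t + k) / w\<close> in the integrals turns \<open>u - x\<close> into \<open>(t + (k - w x)) / w\<close>, so by the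
  multi-binomial theorem the series of \<open>P\<close> is a finite combination of the terms \<open>w\<^sup>-\<^sup>h\<close> with
  products of moments as coefficients; all orders strictly between \<open>0\<close> and \<open>r\<close> drop out.

  The remainder satisfies \<open>\<bar>R u\<bar> \<le> \<epsilon> \<parallel>u - x\<parallel>\<^sup>r + K \<parallel>u - x\<parallel>\<^sup>r [\<parallel>u - x\<parallel> \<ge> d]\<close>. With
  \<open>c = \<Sum>i. 1 / w\<^sub>i\<close> and \<open>q = k - w x\<close> one has \<open>\<parallel>u - x\<parallel> \<le> c \<parallel>t + q\<parallel>\<close>, and \<open>\<parallel>t + q\<parallel>\<close> is at most
  twice the larger of \<open>\<parallel>t\<parallel>\<close> and \<open>\<parallel>q\<parallel>\<close>; hence the far part is controlled by the tails of the two
  \<open>r\<close>-th absolute moments beyond \<open>d / (3 c)\<close>, which vanish as \<open>c \<rightarrow> 0\<close>, while \<open>n c\<close> stays bounded.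
\<close>

section \<open>Multi-indices\<close>

lemma norm_le_of_abs_le:
  fixes v w :: "real ^ 'n::finite"
  assumes "\<And>i. \<bar>v $ i\<bar> \<le> \<bar>w $ i\<bar>"
  shows "norm v \<le> norm w"
  by (intro norm_le_componentwise_cart) (use assms in auto)

text \<open>A product of one-variable binomial sums, expanded by distributivity over all choices of
  exponents. The exponent \<open>h - s\<close> falls on \<open>a\<close> and \<open>s\<close> on
  \<open>b\<close>, as needed later for the discrete and the continuous moment.\<close>

lemma vpow_add:
  fixes a b :: "real ^ 'n::finite"
  shows "vpow (a + b) h = (\<Sum>s\<in>{..h}. real (mi_binom h s) * vpow a (h - s) * vpow b s)"
proof -
  let ?g = "\<lambda>i k. real ((h $ i) choose k) * (b $ i) ^ k * (a $ i) ^ (h $ i - k)"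
  have "vpow (a + b) h = (\<Prod>i\<in>UNIV. \<Sum>k\<le>h $ i. ?g i k)"
    unfolding vpow_def vector_add_component by (subst add.commute) (simp add: binomial_ring)
  also have "\<dots> = (\<Sum>s\<in>PiE UNIV (\<lambda>i. {..h $ i}). \<Prod>i\<in>UNIV. ?g i (s i))"
    by (intro prod_sum_PiE) auto
  also have "\<dots> = (\<Sum>s\<in>{..h}. \<Prod>i\<in>UNIV. ?g i (s $ i))"
    by (rule sum.reindex_bij_witness[of _ vec_nth vec_lambda])
       (auto simp: less_eq_vec_def PiE_def)
  also have "\<dots> = (\<Sum>s\<in>{..h}. real (mi_binom h s) * vpow a (h - s) * vpow b s)"
    by (intro sum.cong refl) (simp add: mi_binom_def vpow_def prod.distrib mult_ac)
  finally show ?thesis .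
qed

lemma abs_vpow_le: "\<bar>vpow v h\<bar> \<le> norm v ^ mi_size h"
proof -
  have "\<bar>vpow v h\<bar> = (\<Prod>i\<in>UNIV. \<bar>v $ i\<bar> ^ (h $ i))"
    by (simp add: vpow_def abs_prod power_abs)
  also have "\<dots> \<le> (\<Prod>i\<in>UNIV. norm v ^ (h $ i))"
    by (intro prod_mono conjI power_mono component_le_norm_cart zero_le_power) auto
  also have "\<dots> = norm v ^ mi_size h"
    by (simp add: mi_size_def power_sum)
  finally show ?thesis .
qed

lemma mi_size_diff_add: "s \<le> h \<Longrightarrow> mi_size (h - s) + mi_size s = mi_size h" for h s :: "nat ^ 'm::finite"
  unfolding mi_size_def less_eq_vec_def by (simp flip: sum.distrib)

section \<open>Taylor's formula\<close>

lemma partials_append: "partials (is @ js) g = partials is (partials js g)"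
  by (simp add: partials_def)

lemma partials_exist_on_partials:
  assumes "partials_exist_on m U g" "length js \<le> m"
  shows "partials_exist_on (m - length js) U (partials js g)"
  using assms unfolding partials_exist_on_def partials_append[symmetric] by auto

section \<open>Multi-indices supported on a list of directions\<close>

definition coord_part :: "'n::finite list \<Rightarrow> real ^ 'n \<Rightarrow> real ^ 'n" where
  "coord_part cs v = (\<chi> i. if i \<in> set cs then v $ i else 0)"

definition mi_upto :: "'n::finite list \<Rightarrow> nat \<Rightarrow> (nat ^ 'n) set" where
  "mi_upto cs m = {h. mi_size h \<le> m \<and> (\<forall>i. i \<notin> set cs \<longrightarrow> h $ i = 0)}"

text \<open>With \<open>cs\<close> the sorted list of all indices this is the word in
  \<open>mi_deriv\<close>. As \<open>partials\<close> applies the last letter first, the induction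
  over directions splits lists at their end.\<close>

definition mi_word :: "'n::finite list \<Rightarrow> nat ^ 'n \<Rightarrow> 'n list" where
  "mi_word cs h = concat (map (\<lambda>i. replicate (h $ i) i) cs)"

lemma finite_mi_size_le: "finite {h :: nat ^ 'n::finite. mi_size h \<le> m}"
proof -
  have "{h :: nat ^ 'n. mi_size h \<le> m} = (\<Union>k\<le>m. {h. mi_size h = k})"
    by auto
  then show ?thesis
    by (simp add: finite_mi_size)
qed

lemma finite_mi_upto: "finite (mi_upto cs m)"
  unfolding mi_upto_def by (rule finite_subset[OF _ finite_mi_size_le[of m]]) auto

definition mi_set :: "'n::finite \<Rightarrow> nat \<Rightarrow> nat ^ 'n \<Rightarrow> nat ^ 'n" where
  "mi_set c j h = (\<chi> i. if i = c then j else h $ i)"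

text \<open>Written additively to avoid truncated subtraction.\<close>

lemma mi_size_set: "mi_size (mi_set c j h) + h $ c = mi_size h + j"
proof -
  have "mi_size (mi_set c j h) = j + (\<Sum>i\<in>UNIV - {c}. h $ i)"
    unfolding mi_size_def by (subst sum.remove[of _ c]) (auto simp: mi_set_def)
  moreover have "mi_size h = h $ c + (\<Sum>i\<in>UNIV - {c}. h $ i)"
    unfolding mi_size_def by (intro sum.remove) auto
  ultimately show ?thesis by simp
qed

lemma mi_fact_set:
  assumes "h $ c = 0"
  shows "mi_fact (mi_set c j h) = fact j * mi_fact h"
proof -
  have "mi_fact (mi_set c j h) = fact j * (\<Prod>i\<in>UNIV - {c}. fact (h $ i))"
    unfolding mi_fact_def by (subst prod.remove[of _ c]) (auto simp: mi_set_def)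
  moreover have "mi_fact h = (\<Prod>i\<in>UNIV - {c}. fact (h $ i))"
    unfolding mi_fact_def by (subst prod.remove[of _ c]) (auto simp: assms)
  ultimately show ?thesis by simp
qed

lemma vpow_set:
  assumes "h $ c = 0"
  shows "vpow v (mi_set c j h) = (v $ c) ^ j * vpow v h"
proof -
  have "vpow v (mi_set c j h) = (v $ c) ^ j * (\<Prod>i\<in>UNIV - {c}. (v $ i) ^ (h $ i))"
    unfolding vpow_def by (subst prod.remove[of _ c]) (auto simp: mi_set_def)
  moreover have "vpow v h = (\<Prod>i\<in>UNIV - {c}. (v $ i) ^ (h $ i))"
    unfolding vpow_def by (subst prod.remove[of _ c]) (auto simp: assms)
  ultimately show ?thesis by simp
qed

text \<open>A multi-index supported on \<open>cs @ [c]\<close> is determined by its entry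
  \<open>j\<close> at \<open>c\<close> and the rest, which is supported on \<open>cs\<close> and has
  size at most \<open>m - j\<close>. Since \<open>c\<close> is not in \<open>cs\<close>, this
  correspondence is bijective.\<close>

lemma sum_mi_upto_snoc:
  fixes F :: "nat ^ 'n::finite \<Rightarrow> 'b::comm_monoid_add"
  assumes "c \<notin> set cs"
  shows "(\<Sum>h\<in>mi_upto (cs @ [c]) m. F h) = (\<Sum>j\<le>m. \<Sum>h\<in>mi_upto cs (m - j). F (mi_set c j h))"
proof -
  have "(\<Sum>j\<le>m. \<Sum>h\<in>mi_upto cs (m - j). F (mi_set c j h)) =
      (\<Sum>(j, h)\<in>(SIGMA j:{..m}. mi_upto cs (m - j)). F (mi_set c j h))"
    by (intro sum.Sigma) (auto simp: finite_mi_upto)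
  also have "\<dots> = (\<Sum>h\<in>mi_upto (cs @ [c]) m. F h)"
  proof (rule sum.reindex_bij_witness[of _ "\<lambda>h. (h $ c, mi_set c 0 h)" "\<lambda>(j, h). mi_set c j h"])
    fix z assume z: "z \<in> (SIGMA j:{..m}. mi_upto cs (m - j))"
    obtain j h where z': "z = (j, h)" by (cases z)
    have h: "h $ c = 0" "mi_size h \<le> m - j" "j \<le> m"
      using z z' assms by (auto simp: mi_upto_def)
    show "(\<lambda>h. (h $ c, mi_set c 0 h)) ((\<lambda>(j, h). mi_set c j h) z) = z"
      using h by (auto simp: z' mi_set_def vec_eq_iff)
    show "(\<lambda>(j, h). mi_set c j h) z \<in> mi_upto (cs @ [c]) m"
      using h z z' mi_size_set[of c j h] by (auto simp: mi_upto_def mi_set_def)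
    show "F ((\<lambda>(j, h). mi_set c j h) z) = (\<lambda>(j, h). F (mi_set c j h)) z"
      by (simp add: z')
  next
    fix h assume h: "h \<in> mi_upto (cs @ [c]) m"
    show "(\<lambda>(j, h). mi_set c j h) (h $ c, mi_set c 0 h) = h"
      by (auto simp: mi_set_def vec_eq_iff)
    show "(h $ c, mi_set c 0 h) \<in> (SIGMA j:{..m}. mi_upto cs (m - j))"
      using h mi_size_set[of c 0 h] by (auto simp: mi_upto_def mi_set_def)
  qed
  finally show ?thesis ..
qed

text \<open>The letters of the last direction form the final block, so the mixed derivative is a
  derivative in the directions \<open>cs\<close> of a pure derivative in direction
  \<open>c\<close>.\<close>

lemma mi_word_set:
  assumes "c \<notin> set cs"
  shows "mi_word (cs @ [c]) (mi_set c j h) = mi_word cs h @ replicate j c"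
proof -
  have "mi_word cs (mi_set c j h) = mi_word cs h"
    unfolding mi_word_def
    by (intro arg_cong[where f = concat] map_cong refl) (use assms in \<open>auto simp: mi_set_def\<close>)
  then show ?thesis
    by (simp add: mi_word_def) (simp add: mi_set_def)
qed

section \<open>Taylor expansion, one direction at a time\<close>

lemma partial_DERIV:
  assumes "partial_differentiable c g (y + t *\<^sub>R axis c 1)"
  shows "((\<lambda>s. g (y + s *\<^sub>R axis c 1)) has_real_derivative partial c g (y + t *\<^sub>R axis c 1)) (at t)"
proof -
  have "((\<lambda>s. g ((y + t *\<^sub>R axis c 1) + s *\<^sub>R axis c 1)) has_real_derivative
      partial c g (y + t *\<^sub>R axis c 1)) (at 0)"
    using assms unfolding partial_differentiable_def partial_def
    by (simp add: field_differentiable_derivI)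
  then have "((\<lambda>s. g (y + (s + t) *\<^sub>R axis c 1)) has_real_derivative
      partial c g (y + t *\<^sub>R axis c 1)) (at 0)"
    by (simp add: scaleR_left_distrib add_ac)
  then show ?thesis
    using DERIV_shift[of "\<lambda>s. g (y + s *\<^sub>R axis c 1)" _ 0 t] by simp
qed

text \<open>Maclaurin's formula with Lagrange remainder along direction \<open>c\<close>, started at
  \<open>x + coord_part cs v\<close>. Subtracting the term of order \<open>m\<close> at the base
  point leaves a difference of two values of the \<open>m\<close>-th derivative near
  \<open>x\<close>, which continuity at \<open>x\<close> makes small.\<close>

lemma taylor_one_direction:
  fixes g :: "real ^ 'n::finite \<Rightarrow> real"
  assumes U: "open U" "x \<in> U" and ex: "partials_exist_on m U g"
    and cont: "isCont (partials (replicate m c) g) x" and c: "c \<notin> set cs"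
  shows "(\<lambda>v. g (x + coord_part (cs @ [c]) v) -
           (\<Sum>j\<le>m. partials (replicate j c) g (x + coord_part cs v) * (v $ c) ^ j / fact j))
         \<in> o[nhds 0](\<lambda>v. norm v ^ m)"
proof (rule landau_o.smallI)
  fix e :: real assume e: "e > 0"
  define G where "G j = partials (replicate j c) g" for j
  obtain d1 where d1: "d1 > 0" "ball x d1 \<subseteq> U"
    using U open_contains_ball by blast
  obtain d2 where d2: "d2 > 0" "\<And>y. dist y x < d2 \<Longrightarrow> \<bar>G m y - G m x\<bar> < e / 2"
    using cont e unfolding continuous_at_eps_delta G_def dist_real_def
    by (meson half_gt_zero)
  have "\<forall>\<^sub>F v::real^'n in nhds 0. norm v < min d1 d2"
    using d1(1) d2(1) unfolding eventually_nhds_metric by (auto intro!: exI[of _ "min d1 d2"])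
  then show "\<forall>\<^sub>F v in nhds 0. norm (g (x + coord_part (cs @ [c]) v) -
           (\<Sum>j\<le>m. partials (replicate j c) g (x + coord_part cs v) * (v $ c) ^ j / fact j))
         \<le> e * norm (norm v ^ m)"
  proof eventually_elim
    case (elim v)
    let ?y = "x + coord_part cs v"
    \<comment> \<open>Since \<open>c\<close> is not in \<open>cs\<close>, every coordinate of the
      displacement is bounded by that of \<open>v\<close>. The whole segment, and with it the
      intermediate point, therefore stays in both balls.\<close>
    have near: "dist (?y + t *\<^sub>R axis c 1) x < min d1 d2" if "\<bar>t\<bar> \<le> \<bar>v $ c\<bar>" for t
    proof -
      have "norm (coord_part cs v + t *\<^sub>R axis c 1) \<le> norm v"
        by (rule norm_le_of_abs_le) (use that c in \<open>auto simp: coord_part_def axis_def\<close>)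
      then show ?thesis
        using elim by (simp add: dist_norm add.assoc)
    qed
    have deriv: "((\<lambda>s. G j (?y + s *\<^sub>R axis c 1)) has_real_derivative
        G (Suc j) (?y + t *\<^sub>R axis c 1)) (at t)" if "j < m" "\<bar>t\<bar> \<le> \<bar>v $ c\<bar>" for j t
    proof -
      have "?y + t *\<^sub>R axis c 1 \<in> U"
        using near[OF that(2)] d1(2) by (auto simp: dist_commute)
      then have "partial_differentiable c (G j) (?y + t *\<^sub>R axis c 1)"
        using ex that(1) unfolding partials_exist_on_def G_def by auto
      then show ?thesis
        using partial_DERIV[of c "G j"] by (simp add: G_def partials_def)
    qed
    obtain t where t: "\<bar>t\<bar> \<le> \<bar>v $ c\<bar>"
      and eq: "G 0 (?y + (v $ c) *\<^sub>R axis c 1) =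
        (\<Sum>j<m. G j (?y + 0 *\<^sub>R axis c 1) / fact j * (v $ c) ^ j) +
        G m (?y + t *\<^sub>R axis c 1) / fact m * (v $ c) ^ m"
      using Maclaurin_bi_le[of "\<lambda>j s. G j (?y + s *\<^sub>R axis c 1)"
          "\<lambda>s. G 0 (?y + s *\<^sub>R axis c 1)" m "v $ c"] deriv by auto
    have split: "x + coord_part (cs @ [c]) v = ?y + (v $ c) *\<^sub>R axis c 1"
      using c by (auto simp: vec_eq_iff coord_part_def axis_def)
    have "g (x + coord_part (cs @ [c]) v) - (\<Sum>j\<le>m. G j ?y * (v $ c) ^ j / fact j) =
        (G m (?y + t *\<^sub>R axis c 1) - G m ?y) / fact m * (v $ c) ^ m"
      using eq unfolding split
      by (simp add: lessThan_Suc_atMost[symmetric] G_def[of 0] partials_def field_simps)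
    moreover have "\<bar>(G m (?y + t *\<^sub>R axis c 1) - G m ?y) / fact m * (v $ c) ^ m\<bar> \<le> e * norm v ^ m"
    proof -
      have "\<bar>G m (?y + t *\<^sub>R axis c 1) - G m x\<bar> < e / 2" "\<bar>G m ?y - G m x\<bar> < e / 2"
        using d2(2) near[OF t] near[of 0] by auto
      then have "\<bar>G m (?y + t *\<^sub>R axis c 1) - G m ?y\<bar> \<le> e"
        by linarith
      moreover have "\<bar>G m (?y + t *\<^sub>R axis c 1) - G m ?y\<bar> / fact m \<le> \<bar>G m (?y + t *\<^sub>R axis c 1) - G m ?y\<bar> / 1"
        by (intro divide_left_mono) (auto simp: fact_ge_1)
      ultimately have "\<bar>G m (?y + t *\<^sub>R axis c 1) - G m ?y\<bar> / fact m \<le> e"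
        by simp
      then show ?thesis
        using e unfolding abs_mult abs_divide power_abs
        by (intro mult_mono power_mono) (auto simp: component_le_norm_cart)
    qed
    ultimately show ?case
      by (simp add: G_def)
  qed
qed

text \<open>
  The directions are split off in the order in which \<^const>\<open>mi_deriv\<close> differentiates,
  so the symmetry of mixed derivatives is never needed.
\<close>

lemma taylor_list:
  fixes g :: "real ^ 'n::finite \<Rightarrow> real"
  assumes U: "open U" "x \<in> U" and "distinct cs" and "partials_exist_on m U g"
    and "\<And>is. length is = m \<Longrightarrow> isCont (partials is g) x"
  shows "(\<lambda>v. g (x + coord_part cs v) -
           (\<Sum>h\<in>mi_upto cs m. partials (mi_word cs h) g x / mi_fact h * vpow v h))
         \<in> o[nhds 0](\<lambda>v. norm v ^ m)"
  using assms(3-)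
proof (induction cs arbitrary: g m rule: rev_induct)
  case Nil
  \<comment> \<open>Without directions only the zero multi-index is left, and the difference
    vanishes identically.\<close>
  have "mi_upto [] m = {0 :: nat ^ 'n}"
    by (auto simp: mi_upto_def vec_eq_iff mi_size_def)
  moreover have "coord_part [] v = 0" for v :: "real ^ 'n"
    by (simp add: coord_part_def vec_eq_iff)
  ultimately show ?case
    by (simp add: mi_word_def partials_def mi_fact_def vpow_def)
next
  case (snoc c cs)
  then have c: "c \<notin> set cs" by simp
  define G where "G j = partials (replicate j c) g" for j
  define R where "R j v = G j (x + coord_part cs v) -
      (\<Sum>h\<in>mi_upto cs (m - j). partials (mi_word cs h) (G j) x / mi_fact h * vpow v h)" for j v
  \<comment> \<open>The induction hypothesis is applied to each pure derivative \<open>G j\<close>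
    at order \<open>m - j\<close>; the derivatives of \<open>G j\<close> of that order are
    derivatives of \<open>g\<close> of order \<open>m\<close>, hence continuous at
    \<open>x\<close>.\<close>
  have R: "R j \<in> o[nhds 0](\<lambda>v. norm v ^ (m - j))" if "j \<le> m" for j
    unfolding R_def
  proof (rule snoc.IH)
    show "distinct cs" using snoc.prems by simp
    show "partials_exist_on (m - j) U (G j)"
      using partials_exist_on_partials[OF snoc.prems(2), of "replicate j c"] that by (simp add: G_def)
    show "isCont (partials is (G j)) x" if "length is = m - j" for "is"
      using snoc.prems(3)[of "is @ replicate j c"] that \<open>j \<le> m\<close> by (simp add: G_def partials_append)
  qed
  \<comment> \<open>The factor of degree \<open>j\<close> restores the order that \<open>R j\<close>
    has lost.\<close>
  have term_small: "(\<lambda>v. (v $ c) ^ j / fact j * R j v) \<in> o[nhds 0](\<lambda>v. norm v ^ m)" if "j \<le> m" for j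
  proof -
    have "(\<lambda>v::real^'n. (v $ c) ^ j / fact j) \<in> O[nhds 0](\<lambda>v. norm v ^ j)"
    proof (rule landau_o.bigI[of 1])
      show "\<forall>\<^sub>F v::real^'n in nhds 0. norm ((v $ c) ^ j / fact j) \<le> 1 * norm (norm v ^ j)"
      proof (rule always_eventually, rule allI)
        fix v :: "real ^ 'n"
        have "\<bar>v $ c\<bar> ^ j / fact j \<le> norm v ^ j / 1"
          by (intro frac_le power_mono) (auto simp: component_le_norm_cart fact_ge_1)
        then show "norm ((v $ c) ^ j / fact j) \<le> 1 * norm (norm v ^ j)"
          by (simp add: power_abs)
      qed
    qed simp
    from landau_o.big_small_mult[OF this R[OF that]] show ?thesis
      using that by (simp flip: power_add)
  qed
  \<comment> \<open>An identity: the coefficients at the moving base point are replaced by their own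
    Taylor polynomials at \<open>x\<close>, at the cost of the weighted remainders
    \<open>R j\<close>.\<close>
  have "g (x + coord_part (cs @ [c]) v) -
      (\<Sum>h\<in>mi_upto (cs @ [c]) m. partials (mi_word (cs @ [c]) h) g x / mi_fact h * vpow v h) =
      (g (x + coord_part (cs @ [c]) v) -
         (\<Sum>j\<le>m. partials (replicate j c) g (x + coord_part cs v) * (v $ c) ^ j / fact j)) +
      (\<Sum>j\<le>m. (v $ c) ^ j / fact j * R j v)" for v
  proof -
    have "(\<Sum>h\<in>mi_upto (cs @ [c]) m. partials (mi_word (cs @ [c]) h) g x / mi_fact h * vpow v h) =
      (\<Sum>j\<le>m. \<Sum>h\<in>mi_upto cs (m - j).
         (v $ c) ^ j / fact j * (partials (mi_word cs h) (G j) x / mi_fact h * vpow v h))"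
      unfolding sum_mi_upto_snoc[OF c]
    proof (intro sum.cong refl)
      fix j h assume "h \<in> mi_upto cs (m - j)"
      then have "h $ c = 0" using c by (simp add: mi_upto_def)
      then show "partials (mi_word (cs @ [c]) (mi_set c j h)) g x / real (mi_fact (mi_set c j h)) *
            vpow v (mi_set c j h) =
         (v $ c) ^ j / fact j * (partials (mi_word cs h) (G j) x / mi_fact h * vpow v h)"
        by (simp add: mi_word_set[OF c] mi_fact_set vpow_set partials_append G_def)
    qed
    then show ?thesis
      by (simp add: R_def G_def right_diff_distrib sum_subtractf sum_distrib_left algebra_simps)
  qed
  moreover have "(\<lambda>v. g (x + coord_part (cs @ [c]) v) -
         (\<Sum>j\<le>m. partials (replicate j c) g (x + coord_part cs v) * (v $ c) ^ j / fact j))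
      \<in> o[nhds 0](\<lambda>v. norm v ^ m)"
    using snoc.prems by (intro taylor_one_direction[OF U]) auto
  moreover have "(\<lambda>v. \<Sum>j\<le>m. (v $ c) ^ j / fact j * R j v) \<in> o[nhds 0](\<lambda>v. norm v ^ m)"
    by (intro big_sum_in_smallo term_small) auto
  ultimately show ?case
    by (simp only: sum_in_smallo(1))
qed

text \<open>The sorted list contains every index, so \<open>coord_part\<close> becomes the identity
  and \<open>mi_upto\<close> loses its support condition.\<close>

lemma taylor_mi_deriv:
  fixes f :: "real ^ 'n::{finite,linorder} \<Rightarrow> real"
  assumes "locally_C_at r f x"
  shows "(\<lambda>v. f (x + v) - (\<Sum>h | mi_size h \<le> r. mi_deriv h f x / mi_fact h * vpow v h))
         \<in> o[nhds 0](\<lambda>v. norm v ^ r)"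
proof -
  obtain U where "open U" "x \<in> U" "partials_exist_on r U f"
      "\<And>is. length is = r \<Longrightarrow> isCont (partials is f) x"
    using assms unfolding locally_C_at_def by auto
  from taylor_list[OF this(1,2) _ this(3,4), of "sorted_list_of_set UNIV"]
  show ?thesis
    by (simp add: mi_upto_def mi_word_def mi_deriv_def coord_part_def)
qed

section \<open>Uniform bounds for the discrete kernel\<close>

lemma abs_vec_component: "\<bar>v :: real ^ 'n::finite\<bar> $ i = \<bar>v $ i\<bar>"
  by (simp add: abs_vec_def)

lemma mi_size_axis: "mi_size (axis i r :: nat ^ 'n::finite) = r"
  by (simp add: mi_size_def axis_def if_distrib sum.delta cong: if_cong)

lemma vpow_abs_axis: "vpow \<bar>v\<bar> (axis i r :: nat ^ 'n::finite) = \<bar>v $ i\<bar> ^ r"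
proof -
  have "vpow \<bar>v\<bar> (axis i r :: nat ^ 'n) = (\<Prod>j\<in>UNIV. if j = i then \<bar>v $ i\<bar> ^ r else 1)"
    unfolding vpow_def by (intro prod.cong refl) (auto simp: axis_def abs_vec_component)
  then show ?thesis by simp
qed

text \<open>The norm is at most the dimension times the largest coordinate, whose power is one of
  the summands. Thus the pure moments, with multi-indices \<open>axis i r\<close>, control the
  moments of the norm.\<close>

lemma norm_power_le_sum:
  fixes v :: "real ^ 'n::finite"
  shows "norm v ^ r \<le> real CARD('n) ^ r * (\<Sum>i\<in>UNIV. \<bar>v $ i\<bar> ^ r)"
proof -
  obtain i where i: "\<And>j. \<bar>v $ j\<bar> \<le> \<bar>v $ i\<bar>"
  proof -
    have "Max (range (\<lambda>j. \<bar>v $ j\<bar>)) \<in> range (\<lambda>j. \<bar>v $ j\<bar>)"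
      by (intro Max_in) auto
    then obtain i where "Max (range (\<lambda>j. \<bar>v $ j\<bar>)) = \<bar>v $ i\<bar>" by (rule rangeE)
    then have "\<bar>v $ j\<bar> \<le> \<bar>v $ i\<bar>" for j
      using Max_ge[of "range (\<lambda>j. \<bar>v $ j\<bar>)" "\<bar>v $ j\<bar>"] by simp
    then show ?thesis using that by blast
  qed
  have "norm v \<le> (\<Sum>j\<in>UNIV. \<bar>v $ j\<bar>)"
    by (rule norm_le_l1_cart)
  also have "\<dots> \<le> real CARD('n) * \<bar>v $ i\<bar>"
    using sum_bounded_above[of UNIV "\<lambda>j. \<bar>v $ j\<bar>" "\<bar>v $ i\<bar>"] i by simp
  finally have "norm v ^ r \<le> real CARD('n) ^ r * \<bar>v $ i\<bar> ^ r"
    unfolding power_mult_distrib[symmetric] by (rule power_mono) simp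
  also have "\<bar>v $ i\<bar> ^ r \<le> (\<Sum>i\<in>UNIV. \<bar>v $ i\<bar> ^ r)"
    by (intro member_le_sum) auto
  finally show ?thesis
    by (simp add: mult_left_mono)
qed


text \<open>Each pure absolute moment is finite and bounds all finite partial sums uniformly in
  \<open>u\<close>; adding them over the coordinates bounds the sums with the norm.\<close>

lemma disc_power_bound:
  fixes \<phi> :: "real ^ 'n::finite \<Rightarrow> real"
  assumes "max_disc_abs_moment r \<phi> < \<infinity>"
  obtains K where "\<And>u F. finite F \<Longrightarrow> (\<Sum>k\<in>F. \<bar>\<phi> (u - lat k)\<bar> * norm (u - lat k) ^ r) \<le> K"
proof -
  define M where "M i = disc_abs_moment \<phi> (axis i r)" for i
  have Mfin: "M i < \<infinity>" for i
  proof -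
    have "M i \<le> max_disc_abs_moment r \<phi>"
      unfolding M_def max_disc_abs_moment_def
      by (intro Max_ge) (auto simp: finite_mi_size mi_size_axis)
    then show ?thesis using assms by (rule le_less_trans)
  qed
  have coord: "(\<Sum>k\<in>F. \<bar>\<phi> (u - lat k)\<bar> * \<bar>(u - lat k) $ i\<bar> ^ r) \<le> enn2real (M i)"
    if F: "finite F" for u F i
  proof -
    let ?g = "\<lambda>k. ennreal (\<bar>\<phi> (u - lat k)\<bar> * vpow \<bar>u - lat k\<bar> (axis i r))"
    have S: "?g summable_on X" for X
      by (rule nonneg_summable_on_complete) (rule zero_le)
    have "sum ?g F = infsum ?g F"
      using F by (rule infsum_finite[symmetric])
    also have "\<dots> \<le> infsum ?g UNIV"
      by (rule infsum_mono_neutral[OF S S]) (rule order_refl, blast, rule zero_le)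
    also have "\<dots> \<le> M i"
      unfolding M_def disc_abs_moment_def by (rule SUP_upper) simp
    finally have "ennreal (\<Sum>k\<in>F. \<bar>\<phi> (u - lat k)\<bar> * \<bar>(u - lat k) $ i\<bar> ^ r) \<le> M i"
      unfolding vpow_abs_axis by (subst sum_ennreal[symmetric]) simp_all
    then show ?thesis
      using enn2real_mono[of "ennreal (\<Sum>k\<in>F. \<bar>\<phi> (u - lat k)\<bar> * \<bar>(u - lat k) $ i\<bar> ^ r)" "M i"] Mfin[of i]
      by (simp add: sum_nonneg)
  qed
  define K where "K = real CARD('n) ^ r * (\<Sum>i\<in>UNIV. enn2real (M i))"
  have "(\<Sum>k\<in>F. \<bar>\<phi> (u - lat k)\<bar> * norm (u - lat k) ^ r) \<le> K" if F: "finite F" for u F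
  proof -
    have "(\<Sum>k\<in>F. \<bar>\<phi> (u - lat k)\<bar> * norm (u - lat k) ^ r) \<le>
        (\<Sum>k\<in>F. \<bar>\<phi> (u - lat k)\<bar> * (real CARD('n) ^ r * (\<Sum>i\<in>UNIV. \<bar>(u - lat k) $ i\<bar> ^ r)))"
      by (intro sum_mono mult_left_mono norm_power_le_sum) auto
    also have "\<dots> = real CARD('n) ^ r * (\<Sum>i\<in>UNIV. \<Sum>k\<in>F. \<bar>\<phi> (u - lat k)\<bar> * \<bar>(u - lat k) $ i\<bar> ^ r)"
      unfolding sum_distrib_left mult.left_commute[of "\<bar>\<phi> _\<bar>"] by (rule sum.swap)
    also have "\<dots> \<le> K"
      unfolding K_def by (intro mult_left_mono sum_mono coord F) auto
    finally show ?thesis .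
  qed
  then show ?thesis using that by blast
qed

lemma finite_int_box: "finite {j :: int ^ 'n::finite. \<forall>i. j $ i \<in> {a..b}}"
proof -
  have "{j :: int ^ 'n. \<forall>i. j $ i \<in> {a..b}} \<subseteq> vec_lambda ` (\<Pi>\<^sub>E i\<in>UNIV. {a..b})"
  proof
    fix s :: "int ^ 'n" assume "s \<in> {j. \<forall>i. j $ i \<in> {a..b}}"
    then have "vec_nth s \<in> (\<Pi>\<^sub>E i\<in>UNIV. {a..b})"
      by auto
    then have "vec_lambda (vec_nth s) \<in> vec_lambda ` (\<Pi>\<^sub>E i\<in>(UNIV::'n set). {a..b})"
      by (rule imageI)
    then show "s \<in> vec_lambda ` (\<Pi>\<^sub>E i\<in>UNIV. {a..b})" by simp
  qed
  then show ?thesis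
    by (rule finite_subset) (auto intro!: finite_PiE)
qed

text \<open>Shifted by the integer parts of \<open>u\<close>, all near lattice points lie in one
  fixed finite box.\<close>

lemma card_lat_near:
  obtains n where "\<And>u :: real ^ 'n::finite. finite {k. norm (u - lat k) \<le> 1} \<and>
    card {k. norm (u - lat k) \<le> 1} \<le> n"
proof -
  \<comment> \<open>A distance of at most 1 plus a fractional part in [0, 1) puts each shifted
    coordinate between -1 and 2.\<close>
  define B where "B = {j :: int ^ 'n. \<forall>i. j $ i \<in> {-1..2}}"
  have fB: "finite B"
    unfolding B_def by (rule finite_int_box)
  have sub: "{k. norm (u - lat k) \<le> 1} \<subseteq> (\<lambda>j. \<chi> i. j $ i + \<lfloor>u $ i\<rfloor>) ` B" for u :: "real ^ 'n"
  proof
    fix k assume "k \<in> {k. norm (u - lat k) \<le> 1}"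
    then have "\<bar>(u - lat k) $ i\<bar> \<le> 1" for i
      using component_le_norm_cart[of "u - lat k" i] by auto
    then have *: "\<bar>u $ i - real_of_int (k $ i)\<bar> \<le> 1" for i
      by (simp add: lat_def)
    have "-1 \<le> k $ i - \<lfloor>u $ i\<rfloor> \<and> k $ i - \<lfloor>u $ i\<rfloor> \<le> 2" for i
      using *[of i] by linarith
    then have "(\<chi> i. k $ i - \<lfloor>u $ i\<rfloor>) \<in> B"
      by (simp add: B_def)
    moreover have "k = (\<chi> i. (\<chi> i. k $ i - \<lfloor>u $ i\<rfloor>) $ i + \<lfloor>u $ i\<rfloor>)"
      by (simp add: vec_eq_iff)
    ultimately show "k \<in> (\<lambda>j. \<chi> i. j $ i + \<lfloor>u $ i\<rfloor>) ` B"
      by (rule rev_image_eqI)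
  qed
  have "finite {k. norm (u - lat k) \<le> 1} \<and> card {k. norm (u - lat k) \<le> 1} \<le> card B" for u :: "real ^ 'n"
    using finite_subset[OF sub] surj_card_le[OF fB sub] fB by blast
  then show ?thesis using that by blast
qed

text \<open>Within distance 1 of \<open>u\<close> there are boundedly many lattice points, each
  contributing at most \<open>B\<close>; farther away the weight of order \<open>r\<close> is at
  least 1, so the sum of order \<open>r\<close> takes over.\<close>

lemma disc_bound:
  fixes \<phi> :: "real ^ 'n::finite \<Rightarrow> real"
  assumes bdd: "\<And>v. \<bar>\<phi> v\<bar> \<le> B"
    and K: "\<And>u F. finite F \<Longrightarrow> (\<Sum>k\<in>F. \<bar>\<phi> (u - lat k)\<bar> * norm (u - lat k) ^ r) \<le> K"
  obtains K0 where "\<And>u F. finite F \<Longrightarrow> (\<Sum>k\<in>F. \<bar>\<phi> (u - lat k)\<bar>) \<le> K0"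
proof -
  obtain n where n: "\<And>u :: real ^ 'n. finite {k. norm (u - lat k) \<le> 1} \<and> card {k. norm (u - lat k) \<le> 1} \<le> n"
    using card_lat_near by blast
  have B: "0 \<le> B" using bdd[of 0] by linarith
  have "(\<Sum>k\<in>F. \<bar>\<phi> (u - lat k)\<bar>) \<le> real n * B + K" if F: "finite F" for u F
  proof -
    let ?A = "{k. norm (u - lat k) \<le> 1}"
    have "(\<Sum>k\<in>F. \<bar>\<phi> (u - lat k)\<bar>) = (\<Sum>k\<in>F \<inter> ?A. \<bar>\<phi> (u - lat k)\<bar>) + (\<Sum>k\<in>F - ?A. \<bar>\<phi> (u - lat k)\<bar>)"
      by (rule sum.Int_Diff[OF F])
    also have "(\<Sum>k\<in>F \<inter> ?A. \<bar>\<phi> (u - lat k)\<bar>) \<le> real (card (F \<inter> ?A)) * B"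
      using sum_bounded_above[of "F \<inter> ?A" "\<lambda>k. \<bar>\<phi> (u - lat k)\<bar>" B] bdd by simp
    also have "\<dots> \<le> real n * B"
      using n[of u] card_mono[of ?A "F \<inter> ?A"] B by (intro mult_right_mono) auto
    also have "(\<Sum>k\<in>F - ?A. \<bar>\<phi> (u - lat k)\<bar>) \<le> (\<Sum>k\<in>F - ?A. \<bar>\<phi> (u - lat k)\<bar> * norm (u - lat k) ^ r)"
    proof (rule sum_mono)
      fix k assume "k \<in> F - ?A"
      then have "1 \<le> norm (u - lat k) ^ r" by (intro one_le_power) auto
      then show "\<bar>\<phi> (u - lat k)\<bar> \<le> \<bar>\<phi> (u - lat k)\<bar> * norm (u - lat k) ^ r"
        using mult_left_mono[of 1 "norm (u - lat k) ^ r" "\<bar>\<phi> (u - lat k)\<bar>"] by simp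
    qed
    also have "\<dots> \<le> K" using K[of "F - ?A"] F by simp
    finally show ?thesis by simp
  qed
  then show ?thesis using that by blast
qed

lemma nonneg_summable_of_bounded:
  fixes g :: "'k \<Rightarrow> real"
  assumes "\<And>k. 0 \<le> g k" "\<And>F. finite F \<Longrightarrow> sum g F \<le> K"
  shows "g summable_on UNIV" "infsum g UNIV \<le> K"
proof -
  show "g summable_on UNIV"
    by (rule nonneg_bdd_above_summable_on) (use assms in \<open>auto intro!: bdd_aboveI2\<close>)
  then show "infsum g UNIV \<le> K"
    by (rule infsum_le_finite_sums) (use assms in auto)
qed

section \<open>The continuous kernel\<close>

lemma measurable_norm_power_lebesgue [measurable]:
  "(\<lambda>t :: real ^ 'n::finite. norm t ^ r) \<in> borel_measurable lebesgue"
  by (rule measurable_completion) measurable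

lemma vpow_measurable [measurable]: "(\<lambda>t. vpow t h) \<in> borel_measurable borel"
  unfolding vpow_def by (intro borel_measurable_continuous_onI continuous_intros)

lemma vpow_measurable_lebesgue [measurable]: "(\<lambda>t. vpow t h) \<in> borel_measurable lebesgue"
  by (rule measurable_completion) (simp add: vpow_measurable)

text \<open>Domination by the finitely many pure moments, each integrable because the largest
  absolute moment of order \<open>r\<close> is finite.\<close>

lemma integrable_norm_power_kernel:
  fixes \<psi> :: "real ^ 'n::finite \<Rightarrow> real"
  assumes fin: "max_cont_abs_moment r \<psi> < \<infinity>" and [measurable]: "\<psi> \<in> borel_measurable lebesgue"
  shows "integrable lebesgue (\<lambda>t. norm t ^ r * \<bar>\<psi> t\<bar>)"
proof -
  have coord: "integrable lebesgue (\<lambda>t. \<bar>t $ i\<bar> ^ r * \<bar>\<psi> t\<bar>)" for i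
  proof (rule integrableI_bounded)
    have "(\<lambda>t :: real ^ 'n. \<bar>t $ i\<bar> ^ r) \<in> borel_measurable borel"
      by (intro borel_measurable_continuous_onI continuous_intros)
    then have [measurable]: "(\<lambda>t :: real ^ 'n. \<bar>t $ i\<bar> ^ r) \<in> borel_measurable lebesgue"
      by (intro measurable_completion) simp
    show "(\<lambda>t. \<bar>t $ i\<bar> ^ r * \<bar>\<psi> t\<bar>) \<in> borel_measurable lebesgue"
      by measurable
    have "cont_abs_moment \<psi> (axis i r) \<le> max_cont_abs_moment r \<psi>"
      unfolding max_cont_abs_moment_def by (intro Max_ge) (auto simp: finite_mi_size mi_size_axis)
    then show "(\<integral>\<^sup>+ t. ennreal (norm (\<bar>t $ i\<bar> ^ r * \<bar>\<psi> t\<bar>)) \<partial>lebesgue) < \<infinity>"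
      using fin by (simp add: cont_abs_moment_def vpow_abs_axis abs_mult)
  qed
  show ?thesis
  proof (rule Bochner_Integration.integrable_bound)
    show "integrable lebesgue (\<lambda>t. real CARD('n) ^ r * (\<Sum>i\<in>UNIV. \<bar>t $ i\<bar> ^ r * \<bar>\<psi> t\<bar>))"
      by (intro integrable_mult_right Bochner_Integration.integrable_sum coord)
    show "(\<lambda>t. norm t ^ r * \<bar>\<psi> t\<bar>) \<in> borel_measurable lebesgue"
      by measurable
    show "AE t in lebesgue. norm (norm t ^ r * \<bar>\<psi> t\<bar>) \<le>
        norm (real CARD('n) ^ r * (\<Sum>i\<in>UNIV. \<bar>t $ i\<bar> ^ r * \<bar>\<psi> t\<bar>))"
    proof (rule AE_I2)
      fix t :: "real ^ 'n"
      have "norm t ^ r * \<bar>\<psi> t\<bar> \<le> (real CARD('n) ^ r * (\<Sum>i\<in>UNIV. \<bar>t $ i\<bar> ^ r)) * \<bar>\<psi> t\<bar>"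
        by (intro mult_right_mono norm_power_le_sum) auto
      also have "\<dots> = real CARD('n) ^ r * (\<Sum>i\<in>UNIV. \<bar>t $ i\<bar> ^ r * \<bar>\<psi> t\<bar>)"
        by (simp add: sum_distrib_right mult.assoc)
      finally show "norm (norm t ^ r * \<bar>\<psi> t\<bar>) \<le>
          norm (real CARD('n) ^ r * (\<Sum>i\<in>UNIV. \<bar>t $ i\<bar> ^ r * \<bar>\<psi> t\<bar>))"
        by (simp add: abs_mult abs_of_nonneg sum_nonneg)
    qed
  qed
qed

text \<open>Dominated convergence with majorant \<open>norm (g t)\<close>: for fixed
  \<open>t\<close> the indicator is zero as soon as \<open>L\<close> reaches
  \<open>norm t\<close>.\<close>

lemma integrable_tail:
  fixes g :: "real ^ 'n::finite \<Rightarrow> real"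
  assumes "integrable lebesgue g"
  shows "integrable lebesgue (\<lambda>t. g t * of_bool (norm t > L))"
    and "((\<lambda>L. LINT t|lebesgue. g t * of_bool (norm t > L)) \<longlongrightarrow> 0) at_top"
proof -
  have [measurable]: "g \<in> borel_measurable lebesgue" using assms by simp
  have [measurable]: "(\<lambda>t :: real ^ 'n. norm t) \<in> borel_measurable lebesgue"
    using measurable_norm_power_lebesgue[of 1] by simp
  have meas: "(\<lambda>t. g t * of_bool (norm t > L)) \<in> borel_measurable lebesgue" for L
    by measurable
  show "integrable lebesgue (\<lambda>t. g t * of_bool (norm t > L))"
    by (rule Bochner_Integration.integrable_bound[OF assms meas]) (auto simp: of_bool_def)
  have "((\<lambda>L. LINT t|lebesgue. g t * of_bool (norm t > L)) \<longlongrightarrow> (LINT t|(lebesgue :: (real ^ 'n) measure). (0::real))) at_top"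
  proof (rule integral_dominated_convergence_at_top[where w = "\<lambda>t. norm (g t)"])
    show "AE t in lebesgue. ((\<lambda>L. g t * of_bool (norm t > L)) \<longlongrightarrow> 0) at_top"
    proof (rule AE_I2)
      fix t :: "real ^ 'n"
      have "\<forall>\<^sub>F L in at_top. g t * of_bool (norm t > L) = 0"
        using eventually_ge_at_top[of "norm t"] by eventually_elim auto
      then show "((\<lambda>L. g t * of_bool (norm t > L)) \<longlongrightarrow> 0) at_top"
        by (rule tendsto_eventually)
    qed
  qed (use assms meas in \<open>auto simp: of_bool_def intro!: always_eventually\<close>)
  then show "((\<lambda>L. LINT t|lebesgue. g t * of_bool (norm t > L)) \<longlongrightarrow> 0) at_top"
    by simp
qed

section \<open>Componentwise dilations\<close>

text \<open>For positive \<open>w\<close>, the point \<open>vdiv (t + q) w\<close> is the solution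
  \<open>u\<close> of \<open>w * u - q = t\<close>.\<close>

definition vdiv :: "real ^ 'n::finite \<Rightarrow> real ^ 'n \<Rightarrow> real ^ 'n" where
  "vdiv v w = (\<chi> i. v $ i / w $ i)"

text \<open>Carries sums over the Euclidean basis, as they occur in the affine change of variables,
  to sums over coordinates.\<close>

lemma sum_Basis_vec:
  fixes F :: "real ^ 'n::finite \<Rightarrow> 'b::comm_monoid_add"
  shows "(\<Sum>j\<in>Basis. F j) = (\<Sum>i\<in>UNIV. F (axis i 1))"
proof -
  have "Basis = range (\<lambda>i. axis i 1 :: real ^ 'n)"
    by (auto simp: Basis_vec_def)
  moreover have "inj (\<lambda>i. axis i 1 :: real ^ 'n)"
    by (auto simp: inj_def axis_eq_axis)
  ultimately show ?thesis
    using sum.reindex[of "\<lambda>i. axis i 1 :: real ^ 'n" UNIV F] unfolding o_def by metis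
qed

lemma prod_Basis_vec:
  fixes F :: "real ^ 'n::finite \<Rightarrow> 'b::comm_monoid_mult"
  shows "(\<Prod>j\<in>Basis. F j) = (\<Prod>i\<in>UNIV. F (axis i 1))"
proof -
  have "Basis = range (\<lambda>i. axis i 1 :: real ^ 'n)"
    by (auto simp: Basis_vec_def)
  moreover have "inj (\<lambda>i. axis i 1 :: real ^ 'n)"
    by (auto simp: inj_def axis_eq_axis)
  ultimately show ?thesis
    using prod.reindex[of "\<lambda>i. axis i 1 :: real ^ 'n" UNIV F] unfolding o_def by metis
qed

text \<open>The affine change of variables for a diagonal matrix, whose determinant is the product
  of its entries.\<close>

lemma
  fixes c b :: "real ^ 'n::finite"
  assumes "\<And>i. c $ i \<noteq> 0"
  shows lebesgue_componentwise_affine: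
      "lebesgue = density (distr lebesgue lebesgue (\<lambda>t. b + c * t)) (\<lambda>_. ennreal \<bar>vprod c\<bar>)"
    and measurable_componentwise_affine: "(\<lambda>t. b + c * t) \<in> lebesgue \<rightarrow>\<^sub>M lebesgue"
proof -
  have nz: "c \<bullet> j \<noteq> 0" if "j \<in> Basis" for j
    using that assms by (auto simp: Basis_vec_def inner_axis)
  have T: "(\<lambda>t. b + (\<Sum>j\<in>Basis. ((c \<bullet> j) * (t \<bullet> j)) *\<^sub>R j)) = (\<lambda>t. b + c * t)"
  proof
    fix t
    have "(\<Sum>i\<in>UNIV. (c $ i * t $ i) *\<^sub>R axis i 1) = c * t"
      unfolding vec_eq_iff
    proof
      fix k
      have "(\<Sum>i\<in>UNIV. (c $ i * t $ i) *\<^sub>R axis i 1) $ k = (\<Sum>i\<in>UNIV. if i = k then c $ k * t $ k else 0)"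
        unfolding sum_component by (intro sum.cong refl) (auto simp: axis_def)
      then show "(\<Sum>i\<in>UNIV. (c $ i * t $ i) *\<^sub>R axis i 1) $ k = (c * t) $ k"
        by simp
    qed
    then show "b + (\<Sum>j\<in>Basis. ((c \<bullet> j) * (t \<bullet> j)) *\<^sub>R j) = b + c * t"
      by (simp add: sum_Basis_vec inner_axis)
  qed
  have D: "(\<Prod>j\<in>Basis. \<bar>c \<bullet> j\<bar>) = \<bar>vprod c\<bar>"
    by (simp add: prod_Basis_vec inner_axis vprod_def abs_prod)
  show "lebesgue = density (distr lebesgue lebesgue (\<lambda>t. b + c * t)) (\<lambda>_. ennreal \<bar>vprod c\<bar>)"
    using lebesgue_affine_euclidean[of "\<lambda>j. c \<bullet> j" b] nz unfolding T D by simp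
  show "(\<lambda>t. b + c * t) \<in> lebesgue \<rightarrow>\<^sub>M lebesgue"
    using lebesgue_affine_measurable[of "\<lambda>j. c \<bullet> j" b] nz unfolding T by simp
qed

lemma vdiv_affine:
  "(\<lambda>t. vdiv (t + q) w) = (\<lambda>t. vdiv q w + (\<chi> i. 1 / w $ i) * t)"
  by (auto simp: vdiv_def vec_eq_iff add_divide_distrib)

lemma vdiv_measurable:
  assumes "\<And>i. w $ i > 0"
  shows "(\<lambda>t. vdiv (t + q) w) \<in> lebesgue \<rightarrow>\<^sub>M lebesgue"
  unfolding vdiv_affine by (rule measurable_componentwise_affine) (use assms in \<open>auto simp: less_imp_neq[symmetric]\<close>)

lemma lebesgue_vdiv:
  fixes w q :: "real ^ 'n::finite"
  assumes "\<And>i. w $ i > 0"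
  shows "lebesgue = density (distr lebesgue lebesgue (\<lambda>t. vdiv (t + q) w)) (\<lambda>_. ennreal (1 / vprod w))"
proof -
  have "\<bar>vprod (\<chi> i. 1 / w $ i)\<bar> = 1 / vprod w"
    using assms by (simp add: vprod_def prod_dividef prod_pos less_imp_le)
  then show ?thesis
    unfolding vdiv_affine
    using lebesgue_componentwise_affine[of "\<chi> i. 1 / w $ i" "vdiv q w"] assms
    by (simp add: less_imp_neq[symmetric])
qed

text \<open>The dilation carries Lebesgue measure to a positive multiple of itself, so null sets
  pull back to null sets.\<close>

lemma AE_vdiv:
  fixes f :: "real ^ 'n::finite \<Rightarrow> real"
  assumes w: "\<And>i. w $ i > 0" and f: "f \<in> borel_measurable lebesgue"
    and "AE u in lebesgue. \<bar>f u\<bar> \<le> C"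
  shows "AE t in lebesgue. \<bar>f (vdiv (t + q) w)\<bar> \<le> C"
proof -
  have pos: "0 < 1 / vprod w" using w by (simp add: vprod_def prod_pos)
  have [measurable]: "(\<lambda>t. vdiv (t + q) w) \<in> lebesgue \<rightarrow>\<^sub>M lebesgue"
    by (rule vdiv_measurable[OF w])
  note [measurable] = f
  have "AE u in density (distr lebesgue lebesgue (\<lambda>t. vdiv (t + q) w)) (\<lambda>_. ennreal (1 / vprod w)). \<bar>f u\<bar> \<le> C"
    using assms(3) by (rule back_subst[where P = "\<lambda>M. AE u in M. \<bar>f u\<bar> \<le> C", OF _ lebesgue_vdiv[OF w]])
  then have "AE u in distr lebesgue lebesgue (\<lambda>t. vdiv (t + q) w). \<bar>f u\<bar> \<le> C"
    using pos by (subst (asm) AE_density) auto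
  moreover have "{u \<in> space lebesgue. \<bar>f u\<bar> \<le> C} \<in> sets lebesgue"
    by measurable
  ultimately show ?thesis
    by (subst (asm) AE_distr_iff) auto
qed

text \<open>The substitution \<open>u = vdiv (t + q) w\<close> has Jacobian
  \<open>1 / vprod w\<close>, which cancels the normalizing factor of the operator.\<close>

lemma kernel_substitution:
  fixes f \<psi> :: "real ^ 'n::finite \<Rightarrow> real"
  assumes w: "\<And>i. w $ i > 0" and f: "f \<in> borel_measurable lebesgue"
    and \<psi>: "\<psi> \<in> borel_measurable lebesgue"
  shows "vprod w * (LINT u|lebesgue. \<psi> (w * u - q) * f u) =
    (LINT t|lebesgue. \<psi> t * f (vdiv (t + q) w))"
proof -
  have pos: "0 < vprod w" using w by (simp add: vprod_def prod_pos)
  have T[measurable]: "(\<lambda>t. vdiv (t + q) w) \<in> lebesgue \<rightarrow>\<^sub>M lebesgue"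
    by (rule vdiv_measurable[OF w])
  have "(\<lambda>u. - q + w * u) \<in> lebesgue \<rightarrow>\<^sub>M lebesgue"
    by (rule measurable_componentwise_affine) (use w in \<open>auto simp: less_imp_neq[symmetric]\<close>)
  then have "(\<lambda>u. w * u - q) \<in> lebesgue \<rightarrow>\<^sub>M lebesgue"
    by simp
  from measurable_compose[OF this \<psi>] have [measurable]: "(\<lambda>u. \<psi> (w * u - q)) \<in> borel_measurable lebesgue" .
  note [measurable] = f
  let ?g = "\<lambda>u. \<psi> (w * u - q) * f u"
  have inv: "w * vdiv (t + q) w - q = t" for t
    using w by (simp add: vec_eq_iff vdiv_def less_imp_neq[symmetric])
  have "(LINT u|lebesgue. ?g u) =
      (LINT u|density (distr lebesgue lebesgue (\<lambda>t. vdiv (t + q) w)) (\<lambda>_. ennreal (1 / vprod w)). ?g u)"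
    by (rule arg_cong[where f = "\<lambda>M. integral\<^sup>L M ?g", OF lebesgue_vdiv[OF w]])
  also have "\<dots> = (LINT u|distr lebesgue lebesgue (\<lambda>t. vdiv (t + q) w). (1 / vprod w) *\<^sub>R ?g u)"
    using pos by (intro integral_density) auto
  also have "\<dots> = (LINT t|lebesgue. (1 / vprod w) *\<^sub>R ?g (vdiv (t + q) w))"
    by (intro integral_distr) auto
  also have "\<dots> = (1 / vprod w) * (LINT t|lebesgue. ?g (vdiv (t + q) w))"
    by simp
  finally show ?thesis
    using pos by (simp add: inv)
qed

section \<open>The remainder estimate\<close>

lemma vpow_vdiv: "vpow (vdiv v w) h = vpow v h * vpow (vdiv 1 w) h"
  by (simp add: vpow_def vdiv_def power_divide flip: prod.distrib)

lemma norm_vdiv_le: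
  assumes "\<And>i. w $ i > 0" "\<And>i. 1 / w $ i \<le> c"
  shows "norm (vdiv v w) \<le> c * norm v"
proof -
  \<comment> \<open>The index type is nonempty, so \<open>undefined\<close> serves as some
    coordinate.\<close>
  have c: "0 \<le> c"
    using assms(1)[of undefined] assms(2)[of undefined] by (meson less_imp_le order_trans zero_le_divide_1_iff)
  have "norm (vdiv v w) \<le> norm (c *\<^sub>R v)"
  proof (rule norm_le_of_abs_le)
    fix i
    have "(1 / w $ i) * \<bar>v $ i\<bar> \<le> c * \<bar>v $ i\<bar>"
      by (intro mult_right_mono assms) auto
    then show "\<bar>vdiv v w $ i\<bar> \<le> \<bar>(c *\<^sub>R v) $ i\<bar>"
      using assms(1)[of i] c by (simp add: vdiv_def abs_mult)
  qed
  then show ?thesis using c by simp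
qed

text \<open>The norm of the sum is at most twice the larger norm. If it exceeds
  \<open>2 * L\<close>, the larger norm exceeds \<open>L\<close>, and the summand belonging to it
  survives its cutoff.\<close>

lemma norm_add_power_tail_le:
  fixes t q :: "'a::real_normed_vector"
  shows "norm (t + q) ^ r * of_bool (norm (t + q) > 2 * L) \<le>
    2 ^ r * (norm t ^ r * of_bool (norm t > L) + norm q ^ r * of_bool (norm q > L))"
proof (cases "norm (t + q) > 2 * L")
  case True
  define m where "m = max (norm t) (norm q)"
  have tri: "norm (t + q) \<le> 2 * m"
    using norm_triangle_ineq[of t q] by (auto simp: m_def)
  with True have m: "m > L" by linarith
  have "norm (t + q) ^ r \<le> 2 ^ r * m ^ r"
    unfolding power_mult_distrib[symmetric] using tri by (intro power_mono) auto
  also have "m ^ r \<le> norm t ^ r * of_bool (norm t > L) + norm q ^ r * of_bool (norm q > L)"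
  proof (cases "norm t \<le> norm q")
    case True
    then have "m = norm q" by (simp add: m_def)
    then show ?thesis using m by simp
  next
    case False
    then have "m = norm t" by (simp add: m_def)
    then show ?thesis using m by simp
  qed
  finally show ?thesis using True by simp
qed auto

lemma norm_add_power_le:
  fixes t q :: "'a::real_normed_vector"
  shows "norm (t + q) ^ r \<le> 2 ^ r * (norm t ^ r + norm q ^ r)"
proof -
  \<comment> \<open>At the level -1 every cutoff condition is true, so the tail inequality becomes
    the one without cutoffs.\<close>
  have "norm (t + q) ^ r \<le> norm (t + q) ^ r * of_bool (norm (t + q) > 2 * (-1))"
    by (smt (verit) mult_cancel_left2 norm_ge_zero of_bool_eq(2))
  also have "\<dots> \<le> 2 ^ r * (norm t ^ r * of_bool (norm t > -1) + norm q ^ r * of_bool (norm q > -1))"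
    by (rule norm_add_power_tail_le)
  also have "\<dots> \<le> 2 ^ r * (norm t ^ r + norm q ^ r)"
    by (intro mult_left_mono add_mono) (auto simp: of_bool_def)
  finally show ?thesis .
qed

lemma power_le_one_plus:
  fixes y :: real
  assumes "0 \<le> y" "m \<le> r"
  shows "y ^ m \<le> 1 + y ^ r"
proof (cases "y \<le> 1")
  case True
  then show ?thesis using power_le_one[of y m] zero_le_power[of y r] assms by linarith
next
  case False
  then show ?thesis using power_increasing[of m r y] assms by linarith
qed

text \<open>Reduces every moment of order at most \<open>r\<close> to those of orders 0 and
  \<open>r\<close>.\<close>

lemma abs_vpow_le_one_plus: "mi_size h \<le> r \<Longrightarrow> \<bar>vpow v h\<bar> \<le> 1 + norm v ^ r"
  using abs_vpow_le[of v h] power_le_one_plus[of "norm v" "mi_size h" r] by simp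

text \<open>Within distance \<open>d\<close> the small-o condition gives the term with
  \<open>e\<close>; beyond it, constants are absorbed into the power of order \<open>r\<close>. The
  bound is restricted to points with \<open>\<bar>f u\<bar> \<le> C\<close> because \<open>f\<close>
  is only essentially bounded.\<close>

lemma taylor_remainder_bound:
  fixes f P :: "real ^ 'n::finite \<Rightarrow> real"
  assumes tay: "(\<lambda>v. f (x + v) - P v) \<in> o[nhds 0](\<lambda>v. norm v ^ r)"
    and P: "\<And>v. \<bar>P v\<bar> \<le> B * (1 + norm v ^ r)" and e: "e > 0"
  obtains d K where "d > 0" "K \<ge> 0"
    "\<And>u. \<bar>f u\<bar> \<le> C \<Longrightarrow> \<bar>f u - P (u - x)\<bar> \<le>
       e * norm (u - x) ^ r + K * (norm (u - x) ^ r * of_bool (norm (u - x) \<ge> d))"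
proof -
  have B: "B \<ge> 0" using order_trans[OF abs_ge_zero P[of 0]] by (simp add: zero_le_mult_iff) (smt (verit) zero_le_power)
  from landau_o.smallD[OF tay e] obtain d where d: "d > 0"
    and near: "\<And>v. dist v 0 < d \<Longrightarrow> norm (f (x + v) - P v) \<le> e * norm (norm v ^ r)"
    unfolding eventually_nhds_metric by blast
  \<comment> \<open>The constant part \<open>\<bar>C\<bar> + B\<close> is multiplied by the ratio of
    \<open>norm (u - x) ^ r\<close> to \<open>d ^ r\<close>, at least 1 in the far region; the
    second \<open>B\<close> comes from the growth of \<open>P\<close>.\<close>
  define K where "K = (\<bar>C\<bar> + B) / d ^ r + B"
  show ?thesis
  proof
    show "d > 0" by (rule d)
    show "K \<ge> 0" using B d by (simp add: K_def)
    fix u assume C: "\<bar>f u\<bar> \<le> C"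
    show "\<bar>f u - P (u - x)\<bar> \<le>
       e * norm (u - x) ^ r + K * (norm (u - x) ^ r * of_bool (norm (u - x) \<ge> d))"
    proof (cases "norm (u - x) \<ge> d")
      case True
      then have "d ^ r \<le> norm (u - x) ^ r" using d by (intro power_mono) auto
      then have one: "1 \<le> norm (u - x) ^ r / d ^ r" using d by simp
      have "\<bar>f u - P (u - x)\<bar> \<le> (\<bar>C\<bar> + B) * 1 + B * norm (u - x) ^ r"
        using P[of "u - x"] C by (simp add: algebra_simps)
      also have "\<dots> \<le> (\<bar>C\<bar> + B) * (norm (u - x) ^ r / d ^ r) + B * norm (u - x) ^ r"
        using one B by (intro add_right_mono mult_left_mono) auto
      also have "\<dots> = K * norm (u - x) ^ r" by (simp add: K_def algebra_simps)
      also have "\<dots> \<le> e * norm (u - x) ^ r + K * norm (u - x) ^ r" using e by simp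
      finally show ?thesis using True by simp
    next
      case False
      then show ?thesis using near[of "u - x"] by simp
    qed
  qed
qed

lemma has_sum_finite_sum:
  fixes g :: "'i \<Rightarrow> 'k \<Rightarrow> 'b::topological_comm_monoid_add"
  assumes "\<And>i. i \<in> I \<Longrightarrow> (g i has_sum S i) A"
  shows "((\<lambda>k. \<Sum>i\<in>I. g i k) has_sum (\<Sum>i\<in>I. S i)) A"
  using assms by (induction I rule: infinite_finite_induct) (auto intro: has_sum_add)

section \<open>Kernels with uniformly bounded moments of orders 0 and r\<close>

locale kernel_pair =
  fixes \<phi> \<psi> :: "real ^ 'n::finite \<Rightarrow> real" and r :: nat and K0 Kr :: real
  assumes phi_sum: "\<And>u F. finite F \<Longrightarrow> (\<Sum>k\<in>F. \<bar>\<phi> (u - lat k)\<bar>) \<le> K0"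
    and phi_power_sum: "\<And>u F. finite F \<Longrightarrow> (\<Sum>k\<in>F. \<bar>\<phi> (u - lat k)\<bar> * norm (u - lat k) ^ r) \<le> Kr"
    and psi: "integrable lebesgue \<psi>"
    and psi_power: "integrable lebesgue (\<lambda>t. norm t ^ r * \<bar>\<psi> t\<bar>)"
begin

text \<open>The threshold comes first, so that this is a family of functions of \<open>u\<close>, as
  in the uniform tail condition.\<close>

definition "phi_tail L u = (\<Sum>\<^sub>\<infinity>k\<in>{k. norm (u - lat k) > L}. \<bar>\<phi> (u - lat k)\<bar> * norm (u - lat k) ^ r)"

definition "psi_tail L = (LINT t|lebesgue. norm t ^ r * \<bar>\<psi> t\<bar> * of_bool (norm t > L))"

definition "psi_mass = (LINT t|lebesgue. \<bar>\<psi> t\<bar>)"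

definition "psi_power_mass = (LINT t|lebesgue. norm t ^ r * \<bar>\<psi> t\<bar>)"

lemma psi_measurable [measurable]: "\<psi> \<in> borel_measurable lebesgue"
  using psi by simp

lemma phi_summable: "(\<lambda>k. \<bar>\<phi> (u - lat k)\<bar>) summable_on UNIV"
  and phi_infsum_le: "(\<Sum>\<^sub>\<infinity>k. \<bar>\<phi> (u - lat k)\<bar>) \<le> K0"
  by (rule nonneg_summable_of_bounded, simp, erule phi_sum)+

lemma phi_power_summable: "(\<lambda>k. \<bar>\<phi> (u - lat k)\<bar> * norm (u - lat k) ^ r) summable_on UNIV"
  and phi_power_infsum_le: "(\<Sum>\<^sub>\<infinity>k. \<bar>\<phi> (u - lat k)\<bar> * norm (u - lat k) ^ r) \<le> Kr"
  by (rule nonneg_summable_of_bounded, simp, erule phi_power_sum)+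

lemma phi_tail_has_sum:
  "((\<lambda>k. \<bar>\<phi> (u - lat k)\<bar> * (norm (u - lat k) ^ r * of_bool (norm (u - lat k) > L))) has_sum phi_tail L u) UNIV"
proof -
  have "((\<lambda>k. \<bar>\<phi> (u - lat k)\<bar> * norm (u - lat k) ^ r) has_sum phi_tail L u) {k. norm (u - lat k) > L}"
    unfolding phi_tail_def
    by (rule has_sum_infsum) (rule summable_on_subset_banach[OF phi_power_summable], simp)
  then show ?thesis
    by (rule has_sum_cong_neutral[THEN iffD1, rotated 3]) auto
qed

text \<open>Comparison with the sums of orders 0 and \<open>r\<close> gives absolute convergence in
  every order between them.\<close>

lemma disc_moment_has_sum:
  assumes "mi_size h \<le> r"
  shows "((\<lambda>k. \<phi> (u - lat k) * vpow (lat k - u) h) has_sum disc_moment \<phi> h u) UNIV"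
proof -
  have "(\<lambda>k. \<bar>\<phi> (u - lat k)\<bar> + \<bar>\<phi> (u - lat k)\<bar> * norm (u - lat k) ^ r) summable_on UNIV"
    by (intro summable_on_add phi_summable phi_power_summable)
  then have "(\<lambda>k. norm (\<phi> (u - lat k) * vpow (lat k - u) h)) summable_on UNIV"
  proof (rule Infinite_Sum.abs_summable_on_comparison_test')
    fix k
    have "\<bar>\<phi> (u - lat k)\<bar> * \<bar>vpow (lat k - u) h\<bar> \<le> \<bar>\<phi> (u - lat k)\<bar> * (1 + norm (u - lat k) ^ r)"
      using abs_vpow_le_one_plus[OF assms, of "lat k - u"]
      unfolding norm_minus_commute[of "lat k" u] by (rule mult_left_mono) simp
    then show "norm (\<phi> (u - lat k) * vpow (lat k - u) h) \<le>
        \<bar>\<phi> (u - lat k)\<bar> + \<bar>\<phi> (u - lat k)\<bar> * norm (u - lat k) ^ r"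
      unfolding real_norm_def abs_mult distrib_left mult_1_right .
  qed
  then have "(\<lambda>k. \<phi> (u - lat k) * vpow (lat k - u) h) summable_on UNIV"
    by (rule Infinite_Sum.abs_summable_summable)
  then show ?thesis
    unfolding disc_moment_def by (rule has_sum_infsum)
qed

lemma cont_moment_integrable:
  assumes "mi_size h \<le> r"
  shows "integrable lebesgue (\<lambda>t. vpow t h * \<psi> t)"
proof (rule Bochner_Integration.integrable_bound)
  show "integrable lebesgue (\<lambda>t. \<bar>\<psi> t\<bar> + norm t ^ r * \<bar>\<psi> t\<bar>)"
    using psi psi_power by simp
  show "(\<lambda>t. vpow t h * \<psi> t) \<in> borel_measurable lebesgue"
    by measurable
  show "AE t in lebesgue. norm (vpow t h * \<psi> t) \<le> norm (\<bar>\<psi> t\<bar> + norm t ^ r * \<bar>\<psi> t\<bar>)"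
  proof (rule AE_I2)
    fix t
    have "\<bar>vpow t h\<bar> * \<bar>\<psi> t\<bar> \<le> (1 + norm t ^ r) * \<bar>\<psi> t\<bar>"
      by (intro mult_right_mono abs_vpow_le_one_plus assms) auto
    then show "norm (vpow t h * \<psi> t) \<le> norm (\<bar>\<psi> t\<bar> + norm t ^ r * \<bar>\<psi> t\<bar>)"
      by (simp add: abs_mult algebra_simps)
  qed
qed

text \<open>The dilation splits off as the factor \<open>vpow (vdiv 1 w) h\<close>; the binomial
  expansion of \<open>q + t\<close> then leaves only continuous moments to integrate.\<close>

lemma vpow_shift_has_integral:
  assumes h: "mi_size h \<le> r"
  shows "integrable lebesgue (\<lambda>t. \<psi> t * vpow (vdiv (t + q) w) h)"
    and "(LINT t|lebesgue. \<psi> t * vpow (vdiv (t + q) w) h) =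
      vpow (vdiv 1 w) h * (\<Sum>s\<in>{..h}. real (mi_binom h s) * vpow q (h - s) * cont_moment \<psi> s)"
proof -
  have expand: "(\<lambda>t. \<psi> t * vpow (vdiv (t + q) w) h) = (\<lambda>t. \<Sum>s\<in>{..h}.
      (vpow (vdiv 1 w) h * real (mi_binom h s) * vpow q (h - s)) * (vpow t s * \<psi> t))"
  proof
    fix t
    show "\<psi> t * vpow (vdiv (t + q) w) h = (\<Sum>s\<in>{..h}.
      (vpow (vdiv 1 w) h * real (mi_binom h s) * vpow q (h - s)) * (vpow t s * \<psi> t))"
    proof -
      have "vpow (vdiv (t + q) w) h = vpow (q + t) h * vpow (vdiv 1 w) h"
        by (subst vpow_vdiv) (simp only: add.commute)
      then show ?thesis
        unfolding vpow_add[of q t] by (simp add: sum_distrib_left sum_distrib_right mult_ac)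
    qed
  qed
  have int: "integrable lebesgue (\<lambda>t. vpow t s * \<psi> t)" if "s \<in> {..h}" for s
    using that h mi_size_diff_add[of s h] by (intro cont_moment_integrable) simp
  show "integrable lebesgue (\<lambda>t. \<psi> t * vpow (vdiv (t + q) w) h)"
    unfolding expand by (intro Bochner_Integration.integrable_sum integrable_mult_right int)
  show "(LINT t|lebesgue. \<psi> t * vpow (vdiv (t + q) w) h) =
      vpow (vdiv 1 w) h * (\<Sum>s\<in>{..h}. real (mi_binom h s) * vpow q (h - s) * cont_moment \<psi> s)"
    unfolding expand
    by (subst Bochner_Integration.integral_sum, intro integrable_mult_right int, assumption)
       (simp add: cont_moment_def sum_distrib_left mult.assoc)
qed

text \<open>The inner sum of the limit formula, with the discrete moments still taken at
  \<open>u\<close>.\<close>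

definition "mixed_moment u h =
  (\<Sum>s\<in>{..h}. real (mi_binom h s) * disc_moment \<phi> (h - s) u * cont_moment \<psi> s)"

definition taylor_poly :: "(nat ^ 'n \<Rightarrow> real) \<Rightarrow> real ^ 'n \<Rightarrow> real" where
  "taylor_poly D v = (\<Sum>h | mi_size h \<le> r. D h * vpow v h)"

lemma taylor_poly_bound: "\<bar>taylor_poly D v\<bar> \<le> (\<Sum>h | mi_size h \<le> r. \<bar>D h\<bar>) * (1 + norm v ^ r)"
proof -
  have "\<bar>taylor_poly D v\<bar> \<le> (\<Sum>h | mi_size h \<le> r. \<bar>D h\<bar> * \<bar>vpow v h\<bar>)"
    unfolding taylor_poly_def abs_mult[symmetric] by (rule sum_abs)
  also have "\<dots> \<le> (\<Sum>h | mi_size h \<le> r. \<bar>D h\<bar> * (1 + norm v ^ r))"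
    by (intro sum_mono mult_left_mono abs_vpow_le_one_plus) auto
  finally show ?thesis by (simp add: sum_distrib_right)
qed

text \<open>Only finite sums are exchanged with the integral and the series; summation over
  \<open>k\<close> turns the powers of \<open>q k\<close> into discrete moments.\<close>

lemma poly_part:
  fixes D :: "nat ^ 'n \<Rightarrow> real" and u :: "real ^ 'n"
  defines "q \<equiv> \<lambda>k. lat k - u"
  shows "integrable lebesgue (\<lambda>t. \<psi> t * taylor_poly D (vdiv (t + q k) w))"
    and "((\<lambda>k. \<phi> (u - lat k) * (LINT t|lebesgue. \<psi> t * taylor_poly D (vdiv (t + q k) w))) has_sum
      (\<Sum>h | mi_size h \<le> r. D h * vpow (vdiv 1 w) h * mixed_moment u h)) UNIV"
proof -
  have expand: "(\<lambda>t. \<psi> t * taylor_poly D (vdiv (t + q k) w)) =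
      (\<lambda>t. \<Sum>h | mi_size h \<le> r. D h * (\<psi> t * vpow (vdiv (t + q k) w) h))" for k
    by (simp add: taylor_poly_def sum_distrib_left mult_ac)
  show "integrable lebesgue (\<lambda>t. \<psi> t * taylor_poly D (vdiv (t + q k) w))"
    unfolding expand
    by (intro Bochner_Integration.integrable_sum integrable_mult_right vpow_shift_has_integral(1)) auto
  have "(LINT t|lebesgue. \<psi> t * taylor_poly D (vdiv (t + q k) w)) =
     (\<Sum>h | mi_size h \<le> r. D h * (vpow (vdiv 1 w) h *
       (\<Sum>s\<in>{..h}. real (mi_binom h s) * vpow (q k) (h - s) * cont_moment \<psi> s)))" for k
    unfolding expand
    by (subst Bochner_Integration.integral_sum)
       (auto intro!: vpow_shift_has_integral(1) sum.cong simp: vpow_shift_has_integral(2))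
  then have eq: "(\<lambda>k. \<phi> (u - lat k) * (LINT t|lebesgue. \<psi> t * taylor_poly D (vdiv (t + q k) w))) =
     (\<lambda>k. \<Sum>h | mi_size h \<le> r. (D h * vpow (vdiv 1 w) h) *
       (\<Sum>s\<in>{..h}. (real (mi_binom h s) * cont_moment \<psi> s) * (\<phi> (u - lat k) * vpow (lat k - u) (h - s))))"
    by (simp add: q_def sum_distrib_left mult_ac)
  have mm: "mixed_moment u h =
     (\<Sum>s\<in>{..h}. (real (mi_binom h s) * cont_moment \<psi> s) * disc_moment \<phi> (h - s) u)" for h
    by (simp add: mixed_moment_def mult_ac)
  show "((\<lambda>k. \<phi> (u - lat k) * (LINT t|lebesgue. \<psi> t * taylor_poly D (vdiv (t + q k) w))) has_sum
      (\<Sum>h | mi_size h \<le> r. D h * vpow (vdiv 1 w) h * mixed_moment u h)) UNIV"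
    unfolding eq mm
  proof (intro has_sum_finite_sum has_sum_cmult_right disc_moment_has_sum)
    fix h s :: "nat ^ 'n" assume "h \<in> {h. mi_size h \<le> r}" "s \<in> {..h}"
    then show "mi_size (h - s) \<le> r" using mi_size_diff_add[of s h] by simp
  qed
qed

text \<open>Both terms of the bound are separated into a part in \<open>t\<close> and a part in
  \<open>q\<close>, at the price of \<open>2 ^ r\<close>, and then integrated against
  \<open>\<bar>\<psi> t\<bar>\<close>.\<close>

lemma remainder_integral_bound:
  assumes G: "integrable lebesgue (\<lambda>t. \<psi> t * G t)" and "0 \<le> c"
    and bound: "AE t in lebesgue. \<bar>G t\<bar> \<le> e * (c * norm (t + q)) ^ r +
        K * ((c * norm (t + q)) ^ r * of_bool (norm (t + q) > 2 * L))"
    and "0 \<le> e" "0 \<le> K"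
  shows "\<bar>LINT t|lebesgue. \<psi> t * G t\<bar> \<le> (2 * c) ^ r *
    (e * (psi_power_mass + norm q ^ r * psi_mass) +
     K * (psi_tail L + norm q ^ r * of_bool (norm q > L) * psi_mass))"
proof -
  let ?B = "\<lambda>t. (2 * c) ^ r *
    (e * (norm t ^ r * \<bar>\<psi> t\<bar> + norm q ^ r * \<bar>\<psi> t\<bar>) +
     K * (norm t ^ r * \<bar>\<psi> t\<bar> * of_bool (norm t > L) + norm q ^ r * of_bool (norm q > L) * \<bar>\<psi> t\<bar>))"
  note tail = integrable_tail(1)[OF psi_power, of L]
  have intB: "integrable lebesgue ?B"
    using psi psi_power tail
    by (intro integrable_mult_right Bochner_Integration.integrable_add integrable_abs) auto
  have "\<bar>LINT t|lebesgue. \<psi> t * G t\<bar> \<le> (LINT t|lebesgue. \<bar>\<psi> t * G t\<bar>)"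
    by (rule integral_abs_bound)
  also have "\<dots> \<le> (LINT t|lebesgue. ?B t)"
  proof (rule integral_mono_AE)
    show "integrable lebesgue (\<lambda>t. \<bar>\<psi> t * G t\<bar>)" using G by simp
    show "integrable lebesgue ?B" by (rule intB)
    show "AE t in lebesgue. \<bar>\<psi> t * G t\<bar> \<le> ?B t"
      using bound
    proof eventually_elim
      case (elim t)
      have "\<bar>G t\<bar> \<le> c ^ r * (e * norm (t + q) ^ r + K * (norm (t + q) ^ r * of_bool (norm (t + q) > 2 * L)))"
        using elim by (simp add: power_mult_distrib algebra_simps)
      also have "\<dots> \<le> c ^ r * (e * (2 ^ r * (norm t ^ r + norm q ^ r)) +
          K * (2 ^ r * (norm t ^ r * of_bool (norm t > L) + norm q ^ r * of_bool (norm q > L))))"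
        using assms(2,4,5)
        by (intro mult_left_mono add_mono norm_add_power_le norm_add_power_tail_le) auto
      finally have "\<bar>\<psi> t\<bar> * \<bar>G t\<bar> \<le> \<bar>\<psi> t\<bar> * \<dots>"
        by (rule mult_left_mono) simp
      also have "\<dots> = ?B t"
        by (simp add: power_mult_distrib algebra_simps)
      finally show ?case by (simp add: abs_mult)
    qed
  qed
  also have "\<dots> = (2 * c) ^ r *
    (e * (psi_power_mass + norm q ^ r * psi_mass) +
     K * (psi_tail L + norm q ^ r * of_bool (norm q > L) * psi_mass))"
  proof -
    have i1: "integrable lebesgue (\<lambda>t. e * (norm t ^ r * \<bar>\<psi> t\<bar> + norm q ^ r * \<bar>\<psi> t\<bar>))"
      using psi psi_power by (intro integrable_mult_right Bochner_Integration.integrable_add) auto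
    have i2: "integrable lebesgue (\<lambda>t. K * (norm t ^ r * \<bar>\<psi> t\<bar> * of_bool (norm t > L) +
        norm q ^ r * of_bool (norm q > L) * \<bar>\<psi> t\<bar>))"
      using psi tail by (intro integrable_mult_right Bochner_Integration.integrable_add) auto
    have a1: "(LINT t|lebesgue. norm t ^ r * \<bar>\<psi> t\<bar> + norm q ^ r * \<bar>\<psi> t\<bar>) =
        psi_power_mass + norm q ^ r * psi_mass"
      using psi psi_power by (subst Bochner_Integration.integral_add) (auto simp: psi_power_mass_def psi_mass_def)
    have a2: "(LINT t|lebesgue. norm t ^ r * \<bar>\<psi> t\<bar> * of_bool (norm t > L) +
        norm q ^ r * of_bool (norm q > L) * \<bar>\<psi> t\<bar>) =
        psi_tail L + norm q ^ r * of_bool (norm q > L) * psi_mass"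
      using psi tail by (subst Bochner_Integration.integral_add) (auto simp: psi_tail_def psi_mass_def)
    show ?thesis
      unfolding integral_mult_right_zero Bochner_Integration.integral_add[OF i1 i2] a1 a2 ..
  qed
  finally show ?thesis .
qed

text \<open>The integral bound is summed against \<open>\<bar>\<phi> (u - lat k)\<bar>\<close>. The
  full sums are replaced by the uniform constants \<open>K0\<close> and \<open>Kr\<close>, while the
  tail is kept because it has to become small.\<close>

lemma remainder_sum_bound:
  assumes E: "\<And>k. \<bar>E k\<bar> \<le> A * (e * (psi_power_mass + norm (u - lat k) ^ r * psi_mass) +
     K * (psi_tail L + norm (u - lat k) ^ r * of_bool (norm (u - lat k) > L) * psi_mass))"
    and nonneg: "0 \<le> A" "0 \<le> e" "0 \<le> K"
  shows "(\<lambda>k. \<phi> (u - lat k) * E k) summable_on UNIV"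
    and "\<bar>\<Sum>\<^sub>\<infinity>k. \<phi> (u - lat k) * E k\<bar> \<le> A * (e * (psi_power_mass * K0 + Kr * psi_mass) +
     K * (psi_tail L * K0 + phi_tail L u * psi_mass))"
proof -
  define S0 where "S0 = (\<Sum>\<^sub>\<infinity>k. \<bar>\<phi> (u - lat k)\<bar>)"
  define Sr where "Sr = (\<Sum>\<^sub>\<infinity>k. \<bar>\<phi> (u - lat k)\<bar> * norm (u - lat k) ^ r)"
  let ?B = "\<lambda>k. A * (e * (psi_power_mass * \<bar>\<phi> (u - lat k)\<bar> + psi_mass * (\<bar>\<phi> (u - lat k)\<bar> * norm (u - lat k) ^ r)) +
     K * (psi_tail L * \<bar>\<phi> (u - lat k)\<bar> +
          psi_mass * (\<bar>\<phi> (u - lat k)\<bar> * (norm (u - lat k) ^ r * of_bool (norm (u - lat k) > L)))))"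
  have B: "(?B has_sum A * (e * (psi_power_mass * S0 + psi_mass * Sr) +
     K * (psi_tail L * S0 + psi_mass * phi_tail L u))) UNIV"
    unfolding S0_def Sr_def
    by (intro has_sum_cmult_right has_sum_add has_sum_infsum phi_summable phi_power_summable phi_tail_has_sum)
  have le: "norm (\<phi> (u - lat k) * E k) \<le> ?B k" for k
  proof -
    have "\<bar>\<phi> (u - lat k)\<bar> * \<bar>E k\<bar> \<le> \<bar>\<phi> (u - lat k)\<bar> * (A * (e * (psi_power_mass + norm (u - lat k) ^ r * psi_mass) +
     K * (psi_tail L + norm (u - lat k) ^ r * of_bool (norm (u - lat k) > L) * psi_mass)))"
      by (intro mult_left_mono E) auto
    also have "\<dots> = ?B k" by (simp add: algebra_simps)
    finally show ?thesis by (simp add: abs_mult)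
  qed
  have abs: "(\<lambda>k. norm (\<phi> (u - lat k) * E k)) summable_on UNIV"
    by (rule Infinite_Sum.abs_summable_on_comparison_test'[OF has_sum_imp_summable[OF B]]) (rule le)
  then show "(\<lambda>k. \<phi> (u - lat k) * E k) summable_on UNIV"
    by (rule Infinite_Sum.abs_summable_summable)
  have mass: "0 \<le> psi_power_mass" "0 \<le> psi_mass" "0 \<le> psi_tail L"
    by (auto simp: psi_power_mass_def psi_mass_def psi_tail_def intro!: Bochner_Integration.integral_nonneg)
  have "\<bar>\<Sum>\<^sub>\<infinity>k. \<phi> (u - lat k) * E k\<bar> \<le> (\<Sum>\<^sub>\<infinity>k. norm (\<phi> (u - lat k) * E k))"
    using norm_infsum_bound[OF abs] by simp
  also have "\<dots> \<le> infsum ?B UNIV"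
    by (rule infsum_mono[OF abs has_sum_imp_summable[OF B]]) (rule le)
  also have "\<dots> = A * (e * (psi_power_mass * S0 + psi_mass * Sr) +
     K * (psi_tail L * S0 + psi_mass * phi_tail L u))"
    by (rule infsumI[OF B])
  also have "\<dots> \<le> A * (e * (psi_power_mass * K0 + psi_mass * Kr) +
     K * (psi_tail L * K0 + psi_mass * phi_tail L u))"
    using nonneg mass phi_infsum_le phi_power_infsum_le
    by (intro mult_left_mono add_mono) (auto simp: S0_def Sr_def)
  finally show "\<bar>\<Sum>\<^sub>\<infinity>k. \<phi> (u - lat k) * E k\<bar> \<le> A * (e * (psi_power_mass * K0 + Kr * psi_mass) +
     K * (psi_tail L * K0 + phi_tail L u * psi_mass))"
    by (simp add: mult_ac)
qed

end

lemma vdiv_shift: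
  assumes "\<And>i. w $ i > 0"
  shows "vdiv (t + b) w - x = vdiv (t + (b - w * x)) w"
proof -
  have "(t $ i + b $ i) / w $ i - x $ i = (t $ i + (b $ i - w $ i * x $ i)) / w $ i" for i
    using assms[of i] by (simp add: field_simps)
  then show ?thesis
    by (simp add: vec_eq_iff vdiv_def)
qed

section \<open>Estimate of the series and vanishing of the scaled remainder\<close>

context kernel_pair
begin

lemma masses_nonneg: "0 \<le> psi_power_mass" "0 \<le> psi_mass" "0 \<le> K0" "0 \<le> Kr"
  using phi_sum[of "{}"] phi_power_sum[of "{}"]
  by (auto simp: psi_power_mass_def psi_mass_def intro!: Bochner_Integration.integral_nonneg)

lemma bounded_dilate_integrable:
  assumes w: "\<And>i. w $ i > 0" and f: "f \<in> borel_measurable lebesgue"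
    and C: "AE u in lebesgue. \<bar>f u\<bar> \<le> C"
  shows "integrable lebesgue (\<lambda>t. \<psi> t * f (vdiv (t + b) w))"
proof (rule Bochner_Integration.integrable_bound)
  show "integrable lebesgue (\<lambda>t. C * \<psi> t)"
    using psi by simp
  have [measurable]: "(\<lambda>t. f (vdiv (t + b) w)) \<in> borel_measurable lebesgue"
    using measurable_compose[OF vdiv_measurable[OF w] f] .
  show "(\<lambda>t. \<psi> t * f (vdiv (t + b) w)) \<in> borel_measurable lebesgue"
    by measurable
  show "AE t in lebesgue. norm (\<psi> t * f (vdiv (t + b) w)) \<le> norm (C * \<psi> t)"
    using AE_vdiv[OF w f C, of b]
  proof eventually_elim
    case (elim t)
    then have "\<bar>\<psi> t\<bar> * \<bar>f (vdiv (t + b) w)\<bar> \<le> \<bar>\<psi> t\<bar> * \<bar>C\<bar>"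
      by (intro mult_left_mono) auto
    then show ?case by (simp add: abs_mult mult.commute)
  qed
qed

text \<open>After the substitution each integral splits into a Taylor part, summed exactly by
  \<open>poly_part\<close>, and an error \<open>E k\<close>, whose series is bounded by
  \<open>remainder_sum_bound\<close>.\<close>

lemma durrmeyer_estimate:
  fixes f :: "real ^ 'n \<Rightarrow> real" and D :: "nat ^ 'n \<Rightarrow> real" and w x :: "real ^ 'n"
  assumes w: "\<And>i. w $ i > 0" and wc: "\<And>i. 1 / w $ i \<le> c" and c: "0 < c"
    and f: "f \<in> borel_measurable lebesgue" and C: "AE u in lebesgue. \<bar>f u\<bar> \<le> C"
    and rem: "\<And>u. \<bar>f u\<bar> \<le> C \<Longrightarrow> \<bar>f u - taylor_poly D (u - x)\<bar> \<le>
       e * norm (u - x) ^ r + K * (norm (u - x) ^ r * of_bool (norm (u - x) \<ge> d))"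
    and nonneg: "0 \<le> e" "0 \<le> K" and d: "0 < d"
  shows "\<bar>durrmeyer_series \<phi> \<psi> w f x -
      (\<Sum>h | mi_size h \<le> r. D h * vpow (vdiv 1 w) h * mixed_moment (w * x) h)\<bar> \<le>
    (2 * c) ^ r * (e * (psi_power_mass * K0 + Kr * psi_mass) +
     K * (psi_tail (d / (3 * c)) * K0 + phi_tail (d / (3 * c)) (w * x) * psi_mass))"
proof -
  define u where "u = w * x"
  \<comment> \<open>A displacement of norm at least \<open>d\<close> forces
    \<open>norm (t + q k) \<ge> d / c\<close>. The denominator 3 makes \<open>2 * L\<close> strictly
    smaller than this, since the tails are cut off by a strict inequality.\<close>
  define L where "L = d / (3 * c)"
  define q where "q k = lat k - u" for k
  define G where "G k t = f (vdiv (t + lat k) w) - taylor_poly D (vdiv (t + q k) w)" for k t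
  define E where "E k = (LINT t|lebesgue. \<psi> t * G k t)" for k
  note poly = poly_part[where D = D and u = u, folded q_def]
  have int_f: "integrable lebesgue (\<lambda>t. \<psi> t * f (vdiv (t + lat k) w))" for k
    by (rule bounded_dilate_integrable[OF w f C])
  have G_split: "(\<lambda>t. \<psi> t * G k t) =
      (\<lambda>t. \<psi> t * f (vdiv (t + lat k) w) - \<psi> t * taylor_poly D (vdiv (t + q k) w))" for k
    by (simp add: G_def right_diff_distrib)
  have int_G: "integrable lebesgue (\<lambda>t. \<psi> t * G k t)" for k
    unfolding G_split by (intro Bochner_Integration.integrable_diff int_f poly(1))
  have E_eq: "(LINT t|lebesgue. \<psi> t * f (vdiv (t + lat k) w)) =
      (LINT t|lebesgue. \<psi> t * taylor_poly D (vdiv (t + q k) w)) + E k" for k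
    unfolding E_def G_split by (subst Bochner_Integration.integral_diff[OF int_f poly(1)]) simp
  have E_bound: "\<bar>E k\<bar> \<le> (2 * c) ^ r * (e * (psi_power_mass + norm (u - lat k) ^ r * psi_mass) +
     K * (psi_tail L + norm (u - lat k) ^ r * of_bool (norm (u - lat k) > L) * psi_mass))" for k
  proof -
    have "AE t in lebesgue. \<bar>G k t\<bar> \<le> e * (c * norm (t + q k)) ^ r +
        K * ((c * norm (t + q k)) ^ r * of_bool (norm (t + q k) > 2 * L))"
      using AE_vdiv[OF w f C, of "lat k"]
    proof eventually_elim
      case (elim t)
      define y where "y = vdiv (t + q k) w"
      have y: "vdiv (t + lat k) w - x = y"
        unfolding y_def q_def u_def by (rule vdiv_shift[OF w])
      have ny: "norm y \<le> c * norm (t + q k)"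
        unfolding y_def by (rule norm_vdiv_le[OF w wc])
      have far: "norm (t + q k) > 2 * L" if "norm y \<ge> d"
      proof -
        have "d \<le> c * norm (t + q k)" using ny that by linarith
        then have "d / c \<le> norm (t + q k)" using c by (simp add: field_simps)
        moreover have "2 * L < d / c" using c d by (simp add: L_def field_simps)
        ultimately show ?thesis by linarith
      qed
      have "\<bar>G k t\<bar> \<le> e * norm y ^ r + K * (norm y ^ r * of_bool (norm y \<ge> d))"
        using rem[OF elim] unfolding y G_def y_def[symmetric] .
      also have "\<dots> \<le> e * (c * norm (t + q k)) ^ r +
        K * ((c * norm (t + q k)) ^ r * of_bool (norm (t + q k) > 2 * L))"
      proof (intro add_mono mult_left_mono mult_mono power_mono ny nonneg)
        show "of_bool (d \<le> norm y) \<le> (of_bool (2 * L < norm (t + q k)) :: real)"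
          using far by (simp add: of_bool_def)
      qed (use c in auto)
      finally show ?case .
    qed
    from remainder_integral_bound[OF int_G _ this nonneg] c
    show ?thesis
      unfolding E_def q_def norm_minus_commute[of "lat k" u] by simp
  qed
  have A: "0 \<le> (2 * c) ^ r" using c by simp
  note S = remainder_sum_bound[OF E_bound A nonneg]
  have "durrmeyer_series \<phi> \<psi> w f x =
      (\<Sum>\<^sub>\<infinity>k. \<phi> (u - lat k) * (LINT t|lebesgue. \<psi> t * f (vdiv (t + lat k) w)))"
    unfolding durrmeyer_series_def u_def
    by (simp only: kernel_substitution[OF w f psi_measurable])
  also have "\<dots> = (\<Sum>\<^sub>\<infinity>k. \<phi> (u - lat k) * (LINT t|lebesgue. \<psi> t * taylor_poly D (vdiv (t + q k) w)) +
       \<phi> (u - lat k) * E k)"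
    unfolding E_eq distrib_left ..
  also have "\<dots> = (\<Sum>h | mi_size h \<le> r. D h * vpow (vdiv 1 w) h * mixed_moment u h) +
      (\<Sum>\<^sub>\<infinity>k. \<phi> (u - lat k) * E k)"
    by (rule infsumI) (rule has_sum_add[OF poly(2) has_sum_infsum[OF S(1)]])
  finally show ?thesis
    using S(2) unfolding u_def L_def by simp
qed

text \<open>Multiplied by \<open>n ^ r\<close>, the factor \<open>(2 * c n) ^ r\<close> stays
  bounded. First \<open>e\<close> is fixed to make one half of the estimate small; then
  \<open>d\<close> and \<open>K\<close> are fixed, and the tails vanish as \<open>n\<close>
  grows.\<close>

lemma remainder_vanishes:
  fixes f :: "real ^ 'n \<Rightarrow> real" and D :: "nat ^ 'n \<Rightarrow> real" and x a :: "real ^ 'n"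
    and p :: "nat \<Rightarrow> real ^ 'n"
  assumes p_pos: "\<And>i n. n \<ge> 1 \<Longrightarrow> p n $ i > 0"
    and p_lim: "\<And>i. filterlim (\<lambda>n. p n $ i) at_top sequentially"
    and a_lim: "\<And>i. (\<lambda>n. real n / p n $ i) \<longlonglongrightarrow> a $ i"
    and tail: "uniform_limit UNIV phi_tail (\<lambda>u. 0) at_top"
    and f: "f \<in> borel_measurable lebesgue" and C: "AE u in lebesgue. \<bar>f u\<bar> \<le> C"
    and tay: "(\<lambda>v. f (x + v) - taylor_poly D v) \<in> o[nhds 0](\<lambda>v. norm v ^ r)"
  shows "(\<lambda>n. real n ^ r * (durrmeyer_series \<phi> \<psi> (p n) f x -
      (\<Sum>h | mi_size h \<le> r. D h * vpow (vdiv 1 (p n)) h * mixed_moment (p n * x) h))) \<longlonglongrightarrow> 0"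
    (is "?R \<longlonglongrightarrow> 0")
proof -
  \<comment> \<open>The sum dominates every reciprocal and has controlled limits: \<open>c n\<close>
    tends to 0 and \<open>n * c n\<close> to the sum of the \<open>a $ i\<close>.\<close>
  define c where "c n = (\<Sum>i\<in>UNIV. 1 / p n $ i)" for n
  have c_pos: "0 < c n" if "n \<ge> 1" for n
    unfolding c_def by (intro sum_pos) (use p_pos[OF that] in auto)
  have c_ge: "1 / p n $ i \<le> c n" if "n \<ge> 1" for n i
    unfolding c_def by (rule member_le_sum) (use p_pos[OF that] in \<open>auto simp: less_imp_le\<close>)
  have "(\<lambda>n. 1 / p n $ i) \<longlonglongrightarrow> 0" for i
    by (rule tendsto_divide_0[OF tendsto_const filterlim_at_top_imp_at_infinity[OF p_lim]])
  then have "c \<longlonglongrightarrow> (\<Sum>i\<in>(UNIV :: 'n set). 0)"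
    unfolding c_def by (rule tendsto_sum)
  then have c_lim: "c \<longlonglongrightarrow> 0" by simp
  have "(\<lambda>n. \<Sum>i\<in>UNIV. real n / p n $ i) \<longlonglongrightarrow> (\<Sum>i\<in>UNIV. a $ i)"
    by (intro tendsto_sum a_lim)
  moreover have "(\<lambda>n. \<Sum>i\<in>UNIV. real n / p n $ i) = (\<lambda>n. real n * c n)"
    by (simp add: c_def sum_distrib_left)
  ultimately have nc_lim: "(\<lambda>n. real n * c n) \<longlonglongrightarrow> (\<Sum>i\<in>UNIV. a $ i)" by simp
  \<comment> \<open>The added 1 leaves room above the limit, so \<open>n * c n\<close> is eventually
    at most \<open>A\<close>.\<close>
  define A where "A = \<bar>\<Sum>i\<in>UNIV. a $ i\<bar> + 1"
  have A: "A \<ge> 0" by (simp add: A_def)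
  have "(\<Sum>i\<in>UNIV. a $ i) < A" unfolding A_def by linarith
  from order_tendstoD(2)[OF nc_lim this]
  have nc_le: "\<forall>\<^sub>F n in sequentially. real n * c n \<le> A"
    by (rule eventually_mono) simp
  define Q where "Q = psi_power_mass * K0 + Kr * psi_mass"
  have Q: "Q \<ge> 0" using masses_nonneg by (simp add: Q_def)
  show ?thesis
  proof (rule tendstoI)
    fix \<eta> :: real assume \<eta>: "\<eta> > 0"
    define Z where "Z = (2 * A) ^ r * Q"
    \<comment> \<open>Chosen so that \<open>Z * e \<le> \<eta> / 2\<close>; adding 1 to
      \<open>Z\<close> keeps the denominator positive.\<close>
    define e where "e = \<eta> / (2 * (Z + 1))"
    have Z: "Z \<ge> 0" using A Q by (simp add: Z_def)
    have e: "e > 0" using \<eta> Z by (simp add: e_def)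
    have "Z * e \<le> \<eta> / 2" using \<eta> Z by (simp add: e_def field_simps)
    then have eQ: "(2 * A) ^ r * Q * e \<le> \<eta> / 2" by (simp add: Z_def)
    from taylor_remainder_bound[OF tay taylor_poly_bound e]
    obtain d K where d: "d > 0" and K: "K \<ge> 0"
      and rem: "\<And>u. \<bar>f u\<bar> \<le> C \<Longrightarrow> \<bar>f u - taylor_poly D (u - x)\<bar> \<le>
       e * norm (u - x) ^ r + K * (norm (u - x) ^ r * of_bool (norm (u - x) \<ge> d))"
      by blast
    define L where "L n = d / (3 * c n)" for n
    have L_lim: "filterlim L at_top sequentially"
      unfolding L_def
    proof (rule LIM_at_top_divide[OF tendsto_const d])
      show "\<forall>\<^sub>F n in sequentially. 0 < 3 * c n"
        by (rule eventually_sequentiallyI[of 1]) (use c_pos in force)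
      show "(\<lambda>n. 3 * c n) \<longlonglongrightarrow> 0"
        by (rule tendsto_mult_right_zero[OF c_lim])
    qed
    have psi_lim: "(\<lambda>n. psi_tail (L n)) \<longlonglongrightarrow> 0"
      using filterlim_compose[OF integrable_tail(2)[OF psi_power] L_lim] by (simp add: psi_tail_def)
    \<comment> \<open>The point \<open>p n * x\<close> moves with \<open>n\<close>, so the tail must
      vanish uniformly in \<open>u\<close>.\<close>
    have phi_lim: "(\<lambda>n. phi_tail (L n) (p n * x)) \<longlonglongrightarrow> 0"
    proof (rule tendstoI)
      fix \<epsilon> :: real assume "\<epsilon> > 0"
      from uniform_limitD[OF tail this]
      have "\<forall>\<^sub>F l in at_top. \<forall>u. dist (phi_tail l u) 0 < \<epsilon>" by simp
      then have "\<forall>\<^sub>F n in sequentially. \<forall>u. dist (phi_tail (L n) u) 0 < \<epsilon>"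
        by (rule eventually_compose_filterlim[OF _ L_lim])
      then show "\<forall>\<^sub>F n in sequentially. dist (phi_tail (L n) (p n * x)) 0 < \<epsilon>"
        by (rule eventually_mono) blast
    qed
    define T where "T n = K * (psi_tail (L n) * K0 + phi_tail (L n) (p n * x) * psi_mass)" for n
    have "(\<lambda>n. (2 * A) ^ r * T n) \<longlonglongrightarrow> (2 * A) ^ r * (K * (0 * K0 + 0 * psi_mass))"
      unfolding T_def by (intro tendsto_intros psi_lim phi_lim)
    then have T_small: "\<forall>\<^sub>F n in sequentially. (2 * A) ^ r * T n < \<eta> / 2"
      using \<eta> by (intro order_tendstoD(2)) auto
    have "\<forall>\<^sub>F n in sequentially. n \<ge> (1::nat)" by (rule eventually_ge_at_top)
    from this nc_le T_small show "\<forall>\<^sub>F n in sequentially. dist (?R n) 0 < \<eta>"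
    proof eventually_elim
      case (elim n)
      let ?d = "durrmeyer_series \<phi> \<psi> (p n) f x -
        (\<Sum>h | mi_size h \<le> r. D h * vpow (vdiv 1 (p n)) h * mixed_moment (p n * x) h)"
      have est: "\<bar>?d\<bar> \<le> (2 * c n) ^ r * (e * Q + T n)"
        unfolding Q_def T_def L_def
        using elim(1) e K d
        by (intro durrmeyer_estimate[OF p_pos c_ge c_pos f C rem]) auto
      \<comment> \<open>The estimate itself gives the sign: its left side is nonnegative and the
        first factor on the right is positive.\<close>
      have eT: "0 \<le> e * Q + T n"
      proof -
        have "0 < (2 * c n) ^ r" using c_pos[OF elim(1)] by simp
        moreover have "0 \<le> (2 * c n) ^ r * (e * Q + T n)" using est by linarith
        ultimately show ?thesis by (simp add: zero_le_mult_iff)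
      qed
      have "real n ^ r * \<bar>?d\<bar> \<le> real n ^ r * ((2 * c n) ^ r * (e * Q + T n))"
        using est by (rule mult_left_mono) simp
      also have "\<dots> = (2 * (real n * c n)) ^ r * (e * Q + T n)"
        by (simp add: power_mult_distrib)
      also have "\<dots> \<le> (2 * A) ^ r * (e * Q + T n)"
        using elim(2) c_pos[OF elim(1)] by (intro mult_right_mono power_mono eT) auto
      also have "\<dots> = (2 * A) ^ r * Q * e + (2 * A) ^ r * T n"
        by (simp add: algebra_simps)
      also have "\<dots> < \<eta>" using eQ elim(3) by linarith
      finally show ?case by (simp add: abs_mult)
    qed
  qed
qed

end

section \<open>The limit\<close>

lemma vpow_zero [simp]: "vpow v 0 = 1"
  by (simp add: vpow_def)

lemma mi_size_eq_0_iff: "mi_size h = 0 \<longleftrightarrow> h = 0"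
  by (simp add: mi_size_def vec_eq_iff)

text \<open>The order 0 term is subtracted, the orders strictly between 0 and \<open>r\<close>
  vanish, and in order \<open>r\<close> the factor \<open>n ^ r\<close> is distributed over the
  coordinates, giving powers of \<open>n / p n $ i\<close>.\<close>

lemma main_part_limit:
  fixes D M :: "nat ^ 'n::finite \<Rightarrow> real" and p :: "nat \<Rightarrow> real ^ 'n"
  assumes r: "r \<ge> 1" and a_lim: "\<And>i. (\<lambda>n. real n / p n $ i) \<longlonglongrightarrow> a $ i"
    and M: "\<And>h. 1 \<le> mi_size h \<Longrightarrow> mi_size h < r \<Longrightarrow> M h = 0"
  shows "(\<lambda>n. real n ^ r * ((\<Sum>h | mi_size h \<le> r. D h * vpow (vdiv 1 (p n)) h * M h) - D 0 * M 0))
    \<longlonglongrightarrow> (\<Sum>h | mi_size h = r. vpow a h * D h * M h)"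
proof -
  have split: "(\<Sum>h | mi_size h \<le> r. D h * vpow v h * M h) - D 0 * M 0 =
      (\<Sum>h | mi_size h = r. D h * vpow v h * M h)" for v
  proof -
    have "(\<Sum>h | mi_size h \<le> r. D h * vpow v h * M h) =
        (\<Sum>h\<in>insert 0 {h. mi_size h = r}. D h * vpow v h * M h)"
    proof (rule sum.mono_neutral_right)
      show "\<forall>h\<in>{h. mi_size h \<le> r} - insert 0 {h. mi_size h = r}. D h * vpow v h * M h = 0"
      proof
        fix h :: "nat ^ 'n" assume h: "h \<in> {h. mi_size h \<le> r} - insert 0 {h. mi_size h = r}"
        then have "1 \<le> mi_size h" using mi_size_eq_0_iff[of h] by (cases "mi_size h = 0") auto
        then show "D h * vpow v h * M h = 0" using M[of h] h by auto
      qed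
    qed (auto simp: finite_mi_size_le mi_size_eq_0_iff[THEN iffD2])
    \<comment> \<open>As \<open>r \<ge> 1\<close>, the zero multi-index is not among those of order
      \<open>r\<close>.\<close>
    also have "\<dots> = D 0 * M 0 + (\<Sum>h | mi_size h = r. D h * vpow v h * M h)"
      using r by (subst sum.insert) (auto simp: finite_mi_size mi_size_eq_0_iff[THEN iffD2])
    finally show ?thesis by simp
  qed
  have scale: "real n ^ r * vpow (vdiv 1 (p n)) h = (\<Prod>i\<in>UNIV. (real n / p n $ i) ^ (h $ i))"
    if "mi_size h = r" for n h
  proof -
    have pow: "real n ^ r = (\<Prod>i\<in>UNIV. real n ^ (h $ i))"
      unfolding that[symmetric] mi_size_def by (rule power_sum)
    show ?thesis
      unfolding pow vpow_def prod.distrib[symmetric]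
      by (intro prod.cong refl) (simp add: vdiv_def power_divide)
  qed
  have eq: "real n ^ r * ((\<Sum>h | mi_size h \<le> r. D h * vpow (vdiv 1 (p n)) h * M h) - D 0 * M 0) =
      (\<Sum>h | mi_size h = r. (\<Prod>i\<in>UNIV. (real n / p n $ i) ^ (h $ i)) * D h * M h)" for n
    unfolding split sum_distrib_left
    by (intro sum.cong refl) (simp only: scale[symmetric] mem_Collect_eq mult_ac)
  show ?thesis
    unfolding eq vpow_def[of a] by (intro tendsto_sum tendsto_mult tendsto_prod tendsto_power tendsto_const a_lim)
qed

lemma disc_moment_const_eq:
  assumes "\<And>u v. disc_moment \<phi> h u = disc_moment \<phi> h v"
  shows "disc_moment \<phi> h u = disc_moment_const \<phi> h"
proof -
  have "disc_moment_const \<phi> h = disc_moment \<phi> h u"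
    unfolding disc_moment_const_def
    by (rule the_equality) (rule allI, rule assms, simp)
  then show ?thesis ..
qed

section \<open>Moments of order zero and multi-indices of order one\<close>

lemma disc_moment_0:
  assumes "\<And>u. ((\<lambda>k. \<phi> (u - lat k)) has_sum 1) UNIV"
  shows "disc_moment \<phi> 0 u = 1"
  unfolding disc_moment_def using infsumI[OF assms[of u]] by simp

lemma disc_moment_const_0:
  assumes "\<And>u. ((\<lambda>k. \<phi> (u - lat k)) has_sum 1) UNIV"
  shows "disc_moment_const \<phi> 0 = 1"
  using disc_moment_const_eq[of \<phi> 0] disc_moment_0[OF assms] by simp

lemma cont_moment_0: "cont_moment \<psi> 0 = (LINT t|lebesgue. \<psi> t)"
  by (simp add: cont_moment_def)

text \<open>Meant for unit multi-indices, below which only 0 and the multi-index itself lie.\<close>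

lemma sum_atMost_endpoints:
  fixes g :: "nat ^ 'n::finite \<Rightarrow> real"
  assumes h: "h \<noteq> 0" and "\<And>s. s \<le> h \<Longrightarrow> s \<noteq> 0 \<Longrightarrow> s \<noteq> h \<Longrightarrow> g s = 0"
  shows "(\<Sum>s\<in>{..h}. g s) = g 0 + g h"
proof -
  have "(\<Sum>s\<in>{..h}. g s) = (\<Sum>s\<in>{0, h}. g s)"
    by (rule sum.mono_neutral_right) (use assms in \<open>auto simp: finite_mi_atMost less_eq_vec_def\<close>)
  then show ?thesis using h by auto
qed

lemma mi_binom_0: "mi_binom h 0 = 1" and mi_binom_self: "mi_binom h h = 1"
  by (simp_all add: mi_binom_def)

lemma mi_deriv_0: "mi_deriv 0 f x = f x"
proof -
  have "concat (map (\<lambda>i. replicate (0 $ i) i) xs) = []" for xs :: "'a list"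
    by (induction xs) auto
  then show ?thesis
    unfolding mi_deriv_def partials_def by (simp only: foldr_Nil id_apply)
qed

lemma mi_deriv_axis: "mi_deriv (axis k 1) f = partial k f"
proof -
  have *: "concat (map (\<lambda>i. replicate (axis k 1 $ i) i) xs) = (if k \<in> set xs then [k] else [])"
    if "distinct xs" for xs :: "'a list"
    using that by (induction xs) (auto simp: axis_def)
  have "k \<in> set (sorted_list_of_set UNIV)" by simp
  then show ?thesis
    unfolding mi_deriv_def by (subst *) (auto simp: partials_def)
qed

lemma mi_size_eq_1_iff: "mi_size (h :: nat ^ 'n::finite) = 1 \<longleftrightarrow> (\<exists>k. h = axis k 1)"
proof
  assume "mi_size h = 1"
  then obtain k where k: "h $ k = 1" "\<And>j. j \<noteq> k \<Longrightarrow> h $ j = 0"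
    using sum_eq_1_iff[of UNIV "vec_nth h"] unfolding mi_size_def by auto
  then show "\<exists>k. h = axis k 1"
    by (intro exI[of _ k]) (auto simp: vec_eq_iff axis_def)
qed (auto simp: mi_size_axis)

lemma sum_mi_size_1:
  fixes g :: "nat ^ 'n::finite \<Rightarrow> real"
  shows "(\<Sum>h | mi_size h = 1. g h) = (\<Sum>k\<in>UNIV. g (axis k 1))"
proof -
  have "{h :: nat ^ 'n. mi_size h = 1} = range (\<lambda>k. axis k 1)"
    using mi_size_eq_1_iff by auto
  moreover have "inj (\<lambda>k :: 'n. axis k (1 :: nat))"
    by (auto simp: inj_def axis_eq_axis)
  ultimately show ?thesis
    using sum.reindex[of "\<lambda>k. axis k 1" UNIV g] by (simp add: o_def)
qed

lemma mi_fact_axis_1: "mi_fact (axis k 1 :: nat ^ 'n::finite) = 1"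
  unfolding mi_fact_def by (intro prod.neutral) (auto simp: axis_def)

lemma vpow_axis_1: "vpow a (axis k 1) = a $ k"
proof -
  have "vpow a (axis k 1) = (\<Prod>j\<in>UNIV. if j = k then a $ k else 1)"
    unfolding vpow_def by (intro prod.cong refl) (auto simp: axis_def)
  then show ?thesis by simp
qed

text \<open>All entries away from \<open>k\<close> are zero, so a nonzero \<open>s\<close> must have
  entry 1 at \<open>k\<close>.\<close>

lemma le_axis_1:
  fixes s :: "nat ^ 'n::finite"
  assumes "s \<le> axis k 1" "s \<noteq> 0"
  shows "s = axis k 1"
proof -
  have le: "s $ i \<le> (if i = k then 1 else 0)" for i
    using assms(1) by (auto simp: less_eq_vec_def axis_def dest: spec[of _ i] split: if_splits)
  obtain j where "s $ j \<noteq> 0" using assms(2) by (auto simp: vec_eq_iff)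
  with le[of j] have "s $ k \<noteq> 0" by (auto split: if_splits)
  then have "s $ i = axis k 1 $ i" for i
    using le[of i] by (cases "i = k") (auto simp: axis_def)
  then show ?thesis
    by (simp add: vec_eq_iff)
qed

text \<open>Covers both cases at once: \<open>vanish\<close> is vacuous for \<open>r = 1\<close> and
  is the moment condition of the second case for \<open>r > 1\<close>.\<close>

lemma durrmeyer_voronovskaja:
  fixes \<phi> \<psi> f :: "real ^ 'n::{finite,linorder} \<Rightarrow> real"
    and p :: "nat \<Rightarrow> real ^ 'n::{finite,linorder}"
    and a x :: "real ^ 'n::{finite,linorder}"
    and r :: nat
  assumes r: "r \<ge> 1"
    and phi: "bounded_unif_cont \<phi>"
    and psi: "integrable lebesgue \<psi>"
    and p_pos: "\<And>i n. n \<ge> 1 \<Longrightarrow> p n $ i > 0"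
    and p_lim: "\<And>i. filterlim (\<lambda>n. p n $ i) at_top sequentially"
    and a_lim: "\<And>i. (\<lambda>n. real n / p n $ i) \<longlonglongrightarrow> a $ i"
    and A1_phi: "\<And>u. ((\<lambda>k. \<phi> (u - lat k)) has_sum 1) UNIV"
    and A1_psi: "(LINT t|lebesgue. \<psi> t) = 1"
    and A2_const: "\<And>h u v. 1 \<le> mi_size h \<Longrightarrow> mi_size h \<le> r \<Longrightarrow>
          disc_moment \<phi> h u = disc_moment \<phi> h v"
    and A3_finite: "max_disc_abs_moment r \<phi> + max_cont_abs_moment r \<psi> < \<infinity>"
    and A3_tail: "uniform_limit UNIV
          (\<lambda>w u. \<Sum>\<^sub>\<infinity>k\<in>{k. norm (u - lat k) > w}. \<bar>\<phi> (u - lat k)\<bar> * norm (u - lat k) ^ r)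
          (\<lambda>u. 0) at_top"
    and f_Linf: "L_infinity f"
    and f_Cr: "locally_C_at r f x"
    and vanish: "\<And>h. 1 \<le> mi_size h \<Longrightarrow> mi_size h < r \<Longrightarrow>
          disc_moment_const \<phi> h = 0 \<and> cont_moment \<psi> h = 0"
  shows "(\<lambda>n. real n ^ r * (durrmeyer_series \<phi> \<psi> (p n) f x - f x)) \<longlonglongrightarrow>
              (\<Sum>h | mi_size h = r. vpow a h * (mi_deriv h f x / real (mi_fact h)) *
                 (\<Sum>s\<in>{..h}. real (mi_binom h s) *
                    disc_moment_const \<phi> (h - s) * cont_moment \<psi> s))"
proof -
  obtain B where B: "\<And>v. \<bar>\<phi> v\<bar> \<le> B"
    using phi unfolding bounded_unif_cont_def bounded_iff by auto
  have fin: "max_disc_abs_moment r \<phi> < \<infinity>" "max_cont_abs_moment r \<psi> < \<infinity>"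
    using A3_finite by auto
  obtain Kr where Kr: "\<And>u F. finite F \<Longrightarrow> (\<Sum>k\<in>F. \<bar>\<phi> (u - lat k)\<bar> * norm (u - lat k) ^ r) \<le> Kr"
    using disc_power_bound[OF fin(1)] by blast
  obtain K0 where K0: "\<And>u F. finite F \<Longrightarrow> (\<Sum>k\<in>F. \<bar>\<phi> (u - lat k)\<bar>) \<le> K0"
    using disc_bound[OF B Kr] by blast
  have psi_meas: "\<psi> \<in> borel_measurable lebesgue" using psi by simp
  interpret kernel_pair \<phi> \<psi> r K0 Kr
    by unfold_locales (fact K0 Kr psi integrable_norm_power_kernel[OF fin(2) psi_meas])+
  obtain C where f: "f \<in> borel_measurable lebesgue" and C: "AE u in lebesgue. \<bar>f u\<bar> \<le> C"
    using f_Linf unfolding L_infinity_def by blast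
  \<comment> \<open>Order 0 is the partition of unity, the higher orders are the constancy
    assumption.\<close>
  have disc: "disc_moment \<phi> h u = disc_moment_const \<phi> h" if "mi_size h \<le> r" for h u
  proof (rule disc_moment_const_eq)
    fix u v
    show "disc_moment \<phi> h u = disc_moment \<phi> h v"
    proof (cases "h = 0")
      case True
      then show ?thesis by (simp add: disc_moment_0[OF A1_phi])
    next
      case False
      then have "1 \<le> mi_size h" using mi_size_eq_0_iff[of h] by linarith
      then show ?thesis using that by (rule A2_const)
    qed
  qed
  define D where "D h = mi_deriv h f x / real (mi_fact h)" for h
  define M where "M h = (\<Sum>s\<in>{..h}. real (mi_binom h s) *
                    disc_moment_const \<phi> (h - s) * cont_moment \<psi> s)" for h
  have mixed: "mixed_moment u h = M h" if "mi_size h \<le> r" for u h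
    unfolding mixed_moment_def M_def
  proof (intro sum.cong refl)
    fix s assume "s \<in> {..h}"
    then have "mi_size (h - s) \<le> r" using mi_size_diff_add[of s h] that by simp
    then show "real (mi_binom h s) * disc_moment \<phi> (h - s) u * cont_moment \<psi> s =
        real (mi_binom h s) * disc_moment_const \<phi> (h - s) * cont_moment \<psi> s"
      by (simp add: disc)
  qed
  \<comment> \<open>In each summand either \<open>s = 0\<close> and the discrete moment has the
    order of \<open>h\<close>, or \<open>s\<close> has order between 1 and \<open>r - 1\<close> and
    its continuous moment vanishes.\<close>
  have M_vanish: "M h = 0" if h: "1 \<le> mi_size h" "mi_size h < r" for h
    unfolding M_def
  proof (rule sum.neutral, rule ballI)
    fix s assume s: "s \<in> {..h}"
    then have sz: "mi_size (h - s) + mi_size s = mi_size h" using mi_size_diff_add[of s h] by simp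
    show "real (mi_binom h s) * disc_moment_const \<phi> (h - s) * cont_moment \<psi> s = 0"
    proof (cases "mi_size s = 0")
      case True
      then have "disc_moment_const \<phi> (h - s) = 0" using vanish[of "h - s"] sz h by simp
      then show ?thesis by simp
    next
      case False
      then have "cont_moment \<psi> s = 0" using vanish[of s] sz h by simp
      then show ?thesis by simp
    qed
  qed
  \<comment> \<open>Both kernels have total mass 1, so the order 0 term reproduces
    \<open>f x\<close>.\<close>
  have M0: "D 0 * M 0 = f x"
  proof -
    have "{..0 :: nat ^ 'n::{finite,linorder}} = {0}" by (auto simp: less_eq_vec_def vec_eq_iff)
    then show ?thesis
      by (simp add: D_def M_def mi_deriv_0 mi_fact_def mi_binom_0
          disc_moment_const_0[OF A1_phi] cont_moment_0 A1_psi)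
  qed
  have tail: "uniform_limit UNIV phi_tail (\<lambda>u. 0) at_top"
    using A3_tail unfolding phi_tail_def .
  have tay: "(\<lambda>v. f (x + v) - taylor_poly D v) \<in> o[nhds 0](\<lambda>v. norm v ^ r)"
    using taylor_mi_deriv[OF f_Cr] unfolding taylor_poly_def D_def .
  have sums: "(\<Sum>h | mi_size h \<le> r. D h * vpow (vdiv 1 (p n)) h * mixed_moment (p n * x) h) =
      (\<Sum>h | mi_size h \<le> r. D h * vpow (vdiv 1 (p n)) h * M h)" for n
    by (intro sum.cong refl) (simp add: mixed)
  have rem: "(\<lambda>n. real n ^ r * (durrmeyer_series \<phi> \<psi> (p n) f x -
      (\<Sum>h | mi_size h \<le> r. D h * vpow (vdiv 1 (p n)) h * M h))) \<longlonglongrightarrow> 0"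
    using remainder_vanishes[OF p_pos p_lim a_lim tail f C tay] unfolding sums .
  \<comment> \<open>In the sum of the two sequences the Taylor part cancels, leaving the series
    minus \<open>f x\<close>.\<close>
  from tendsto_add[OF rem main_part_limit[where M = M and D = D, OF r a_lim M_vanish]]
  show "(\<lambda>n. real n ^ r * (durrmeyer_series \<phi> \<psi> (p n) f x - f x)) \<longlonglongrightarrow>
              (\<Sum>h | mi_size h = r. vpow a h * (mi_deriv h f x / real (mi_fact h)) *
                 (\<Sum>s\<in>{..h}. real (mi_binom h s) *
                    disc_moment_const \<phi> (h - s) * cont_moment \<psi> s))"
    unfolding M0 by (simp add: D_def M_def flip: distrib_left)
qed

theorem corollary1:
  fixes \<phi> \<psi> f :: "real ^ 'n::{finite,linorder} \<Rightarrow> real"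
    and p :: "nat \<Rightarrow> real ^ 'n::{finite,linorder}"
    and a x :: "real ^ 'n::{finite,linorder}"
    and r :: nat
  assumes r: "r \<ge> 1"
    and phi: "bounded_unif_cont \<phi>"
    and psi: "integrable lebesgue \<psi>"
    and p_pos: "\<And>i n. n \<ge> 1 \<Longrightarrow> p n $ i > 0"
    and p_lim: "\<And>i. filterlim (\<lambda>n. p n $ i) at_top sequentially"
    and a_pos: "\<And>i. a $ i > 0"
    and a_lim: "\<And>i. (\<lambda>n. real n / p n $ i) \<longlonglongrightarrow> a $ i"
    and A1_phi: "\<And>u. ((\<lambda>k. \<phi> (u - lat k)) has_sum 1) UNIV"
    and A1_psi: "(LINT t|lebesgue. \<psi> t) = 1"
    and A2_summable: "\<And>h u. 1 \<le> mi_size h \<Longrightarrow> mi_size h \<le> r \<Longrightarrow>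
          (\<lambda>k. \<phi> (u - lat k) * vpow (lat k - u) h) summable_on UNIV"
    and A2_const: "\<And>h u v. 1 \<le> mi_size h \<Longrightarrow> mi_size h \<le> r \<Longrightarrow>
          disc_moment \<phi> h u = disc_moment \<phi> h v"
    and A3_finite: "max_disc_abs_moment r \<phi> + max_cont_abs_moment r \<psi> < \<infinity>"
    and A3_tail: "uniform_limit UNIV
          (\<lambda>w u. \<Sum>\<^sub>\<infinity>k\<in>{k. norm (u - lat k) > w}. \<bar>\<phi> (u - lat k)\<bar> * norm (u - lat k) ^ r)
          (\<lambda>u. 0) at_top"
    and f_Linf: "L_infinity f"
    and f_Cr: "locally_C_at r f x"
  shows "(r = 1 \<longrightarrow>
            (\<lambda>n. real n * (durrmeyer_series \<phi> \<psi> (p n) f x - f x)) \<longlonglongrightarrow>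
              (\<Sum>h | mi_size h = 1. vpow a h * mi_deriv h f x *
                 (\<Sum>s\<in>{..h}. real (mi_binom h s) *
                    disc_moment_const \<phi> (h - s) * cont_moment \<psi> s)) \<and>
            (\<Sum>h | mi_size h = 1. vpow a h * mi_deriv h f x *
                 (\<Sum>s\<in>{..h}. real (mi_binom h s) *
                    disc_moment_const \<phi> (h - s) * cont_moment \<psi> s)) =
              (\<Sum>k\<in>UNIV. a $ k * partial k f x *
                 (disc_moment_const \<phi> (axis k 1) + cont_moment \<psi> (axis k 1)))) \<and>
         (r > 1 \<longrightarrow>
            (\<forall>h. 1 \<le> mi_size h \<and> mi_size h \<le> r - 1 \<longrightarrow>
               disc_moment_const \<phi> h = 0 \<and> cont_moment \<psi> h = 0) \<longrightarrow>
            (\<exists>h. mi_size h = r \<and> disc_moment_const \<phi> h \<noteq> 0 \<and> cont_moment \<psi> h \<noteq> 0) \<longrightarrow>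
            (\<lambda>n. real n ^ r * (durrmeyer_series \<phi> \<psi> (p n) f x - f x)) \<longlonglongrightarrow>
              (\<Sum>h | mi_size h = r. vpow a h * (mi_deriv h f x / real (mi_fact h)) *
                 (\<Sum>s\<in>{..h}. real (mi_binom h s) *
                    disc_moment_const \<phi> (h - s) * cont_moment \<psi> s)))"
proof -
  let ?inner = "\<lambda>h. \<Sum>s\<in>{..h}. real (mi_binom h s) * disc_moment_const \<phi> (h - s) * cont_moment \<psi> s"
  have limit: "(\<lambda>n. real n ^ r * (durrmeyer_series \<phi> \<psi> (p n) f x - f x)) \<longlonglongrightarrow>
      (\<Sum>h | mi_size h = r. vpow a h * (mi_deriv h f x / real (mi_fact h)) * ?inner h)"
    if "\<And>h. 1 \<le> mi_size h \<Longrightarrow> mi_size h < r \<Longrightarrow>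
      disc_moment_const \<phi> h = 0 \<and> cont_moment \<psi> h = 0"
    by (rule durrmeyer_voronovskaja) (fact assms that)+
  show ?thesis
  proof (intro conjI impI)
    assume r1: "r = 1"
    \<comment> \<open>Only the endpoints contribute, and each pairs a first moment of one kernel
      with the total mass 1 of the other.\<close>
    have inner_eq: "?inner (axis k 1) = disc_moment_const \<phi> (axis k 1) + cont_moment \<psi> (axis k 1)" for k
    proof -
      have nz: "axis k 1 \<noteq> (0 :: nat ^ 'n::{finite,linorder})"
        by (simp add: axis_eq_0_iff)
      have diff: "axis k 1 - 0 = (axis k 1 :: nat ^ 'n::{finite,linorder})"
          "axis k 1 - axis k 1 = (0 :: nat ^ 'n::{finite,linorder})"
        by (simp_all add: vec_eq_iff)
      show ?thesis
        by (subst sum_atMost_endpoints[OF nz])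
           (use le_axis_1 in \<open>auto simp: diff mi_binom_0 mi_binom_self disc_moment_const_0[OF A1_phi]
              cont_moment_0 A1_psi\<close>)
    qed
    show "(\<Sum>h | mi_size h = 1. vpow a h * mi_deriv h f x * ?inner h) =
        (\<Sum>k\<in>UNIV. a $ k * partial k f x *
           (disc_moment_const \<phi> (axis k 1) + cont_moment \<psi> (axis k 1)))"
      unfolding sum_mi_size_1 inner_eq vpow_axis_1 mi_deriv_axis ..
    have "(\<Sum>h | mi_size h = 1. vpow a h * (mi_deriv h f x / real (mi_fact h)) * ?inner h) =
        (\<Sum>h | mi_size h = 1. vpow a h * mi_deriv h f x * ?inner h)"
      unfolding sum_mi_size_1 mi_fact_axis_1 by simp
    then show "(\<lambda>n. real n * (durrmeyer_series \<phi> \<psi> (p n) f x - f x)) \<longlonglongrightarrow>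
        (\<Sum>h | mi_size h = 1. vpow a h * mi_deriv h f x * ?inner h)"
      using limit by (simp add: r1)
  next
    assume "\<forall>h. 1 \<le> mi_size h \<and> mi_size h \<le> r - 1 \<longrightarrow>
        disc_moment_const \<phi> h = 0 \<and> cont_moment \<psi> h = 0"
    then show "(\<lambda>n. real n ^ r * (durrmeyer_series \<phi> \<psi> (p n) f x - f x)) \<longlonglongrightarrow>
        (\<Sum>h | mi_size h = r. vpow a h * (mi_deriv h f x / real (mi_fact h)) * ?inner h)"
      by (intro limit) auto
  qed
qed

end
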